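(* Let $t>c\ge 1$ be coprime integers. Then there exists a simple planar graph $G=(V,E)$ and an edge $e\in E$ such that \[ \rho(G,e)=\frac{c}{t} \] and \[ |V|\ \le\ C\cdot \max\Big\{\frac{t}{c},\ \frac{t}{t-c},\ \log t\Big\}, \] where $C>0$ is a universal constant (independent of $t,c$).
   Context: For a connected graph $G=(V,E)$ without loops, $\tau(G)$ denotes the number of spanning trees of $G$. For an edge $e\in E$, $G/e$ denotes the graph obtained by contracting $e$ and removing all resulting loops (multiple edges are kept). The effective resistance is $\rho(G,e):=\tau(G/e)/\tau(G)$. A simple graph is one with no loops and no multiple edges. *)

theory Defs
  imports "HOL-Analysis.Analysis"
begin

(* Undirected multigraphs: edges are abstract names, and an edge f joins the one (loop) or
   two elements of "ends G f". *)

record ('v, 'e) mgraph =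
  verts :: "'v set"
  edges :: "'e set"
  ends :: "'e \<Rightarrow> 'v set"

definition fin_mgraph :: "('v, 'e) mgraph \<Rightarrow> bool" where
  "fin_mgraph G \<longleftrightarrow> finite (verts G) \<and> finite (edges G) \<and>
     (\<forall>f\<in>edges G. ends G f \<subseteq> verts G \<and> card (ends G f) \<in> {1, 2})"

definition loopless :: "('v, 'e) mgraph \<Rightarrow> bool" where
  "loopless G \<longleftrightarrow> (\<forall>f\<in>edges G. card (ends G f) \<noteq> 1)"

definition simple_mgraph :: "('v, 'e) mgraph \<Rightarrow> bool" where
  "simple_mgraph G \<longleftrightarrow> loopless G \<and> inj_on (ends G) (edges G)"

definition adjacency :: "('v, 'e) mgraph \<Rightarrow> 'v rel" where
  "adjacency G = {(u, v). \<exists>f\<in>edges G. ends G f = {u, v}}"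

definition connected_mgraph :: "('v, 'e) mgraph \<Rightarrow> bool" where
  "connected_mgraph G \<longleftrightarrow> verts G \<noteq> {} \<and>
     (\<forall>u\<in>verts G. \<forall>v\<in>verts G. (u, v) \<in> (adjacency G)\<^sup>*)"

(* A loop is a cycle of length 1 and a pair of parallel edges is a cycle of length 2. *)

definition is_cycle :: "('v, 'e) mgraph \<Rightarrow> 'v list \<Rightarrow> 'e list \<Rightarrow> bool" where
  "is_cycle G vs fs \<longleftrightarrow> fs \<noteq> [] \<and> length vs = length fs \<and> distinct vs \<and> distinct fs \<and>
     set fs \<subseteq> edges G \<and>
     (\<forall>i<length fs. ends G (fs ! i) = {vs ! i, vs ! (Suc i mod length fs)})"

definition acyclic_mgraph :: "('v, 'e) mgraph \<Rightarrow> bool" where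
  "acyclic_mgraph G \<longleftrightarrow> \<not> (\<exists>vs fs. is_cycle G vs fs)"

definition is_tree :: "('v, 'e) mgraph \<Rightarrow> bool" where
  "is_tree G \<longleftrightarrow> connected_mgraph G \<and> acyclic_mgraph G"

definition spanning_trees :: "('v, 'e) mgraph \<Rightarrow> 'e set set" where
  "spanning_trees G = {T. T \<subseteq> edges G \<and> is_tree (G\<lparr>edges := T\<rparr>)}"

definition tau :: "('v, 'e) mgraph \<Rightarrow> nat" where
  "tau G = card (spanning_trees G)"

(* The vertices of G/e are classes of vertices of G: the set of ends of e is one class, and
   all other classes are singletons. The edges that become loops, e among them, are removed;
   parallel edges stay distinct because they keep their names. *)

definition merge_ends :: "('v, 'e) mgraph \<Rightarrow> 'e \<Rightarrow> 'v \<Rightarrow> 'v set" where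
  "merge_ends G e v = (if v \<in> ends G e then ends G e else {v})"

definition contract :: "('v, 'e) mgraph \<Rightarrow> 'e \<Rightarrow> ('v set, 'e) mgraph" where
  "contract G e =
     \<lparr>verts = merge_ends G e ` verts G,
      edges = {f \<in> edges G. card (merge_ends G e ` ends G f) \<noteq> 1},
      ends = (\<lambda>f. merge_ends G e ` ends G f)\<rparr>"

definition eff_resistance :: "('v, 'e) mgraph \<Rightarrow> 'e \<Rightarrow> real" where
  "eff_resistance G e = real (tau (contract G e)) / real (tau G)"

(* Library simple paths may be closed: a loop is drawn as a simple closed curve, any other
   edge as an arc. *)

definition plane_drawing ::
  "('v, 'e) mgraph \<Rightarrow> ('v \<Rightarrow> real \<times> real) \<Rightarrow> ('e \<Rightarrow> real \<Rightarrow> real \<times> real) \<Rightarrow> bool" where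
  "plane_drawing G p \<gamma> \<longleftrightarrow> inj_on p (verts G) \<and>
     (\<forall>f\<in>edges G. simple_path (\<gamma> f) \<and>
        {pathstart (\<gamma> f), pathfinish (\<gamma> f)} = p ` ends G f \<and>
        path_image (\<gamma> f) \<inter> p ` verts G = p ` ends G f) \<and>
     (\<forall>f\<in>edges G. \<forall>g\<in>edges G. f \<noteq> g \<longrightarrow>
        path_image (\<gamma> f) \<inter> path_image (\<gamma> g) \<subseteq> p ` (ends G f \<inter> ends G g))"

definition planar_mgraph :: "('v, 'e) mgraph \<Rightarrow> bool" where
  "planar_mgraph G \<longleftrightarrow> (\<exists>p \<gamma>. plane_drawing G p \<gamma>)"

end

theory Submission
  imports Defs
begin

text \<open>Let \<open>G\<close> be a two-terminal series-parallel network \<open>N\<close> together with an edge \<open>e\<close> joining the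
  terminals. If \<open>N\<close> has \<open>a\<close> spanning trees and \<open>b\<close> spanning forests with two components separating the
  terminals, then \<open>\<rho>(G, e) = b / (a + b)\<close>, and \<open>b / a\<close> is the resistance of \<open>N\<close>. So it is enough to build
  a network of resistance \<open>c / (t - c)\<close> with few resistors; using paths of two edges as resistors keeps the
  graph simple.

  For the number of resistors, run the Euclidean algorithm, where a step with partial quotient \<open>k\<close> costs
  \<open>k\<close> resistors. Small partial quotients cost \<open>O(log t)\<close> altogether. At a large partial quotient, about
  \<open>4 ^ J\<close>, a gadget that magnifies by 4 with three resistors reduces to a number of bounded size whose denominator
  has the factor \<open>4 ^ J\<close>. Subtracting from it a suitable dyadic number with denominator \<open>2 * 4 ^ J\<close>, which is
  a sum of three numbers of resistor cost \<open>O(J)\<close>, makes the next \<open>J\<close> partial quotients equal to 1, so that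
  the Euclidean algorithm gains a factor exponential in \<open>J\<close> for \<open>O(J)\<close> resistors.\<close>

section \<open>Resistances of series-parallel networks\<close>

text \<open>The Euclidean algorithm alone fails because a partial quotient \<open>k\<close> costs
  \<open>k\<close> resistors but shrinks the numbers only by a factor of about \<open>k\<close>, a
  logarithmic gain. Magnification lowers the price to \<open>O(log k)\<close>, yet the factor
  \<open>4 ^ J\<close> in the denominator cancels the gain: numerator plus denominator keeps its
  order of magnitude. What is left is a choice. Odd multiples of \<open>1 / (2 * 4 ^ J)\<close> are
  \<open>1 / 4 ^ J\<close> apart, and the fractions whose expansion begins with \<open>J\<close>
  quotients 1 fill an interval of at least that length, so one subtraction can always force these
  quotients. Progress is measured by \<open>log (3 / 2) (p + q)\<close>, and each reduction costs at
  most a constant per unit of progress. Only the very first quotient escapes this accounting: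
  \<open>n\<close> unit resistors cannot leave the range from \<open>1 / n\<close> to
  \<open>n\<close>, which is the origin of \<open>t / c\<close> and \<open>t / (t - c)\<close> in
  the bound.

  Planarity shapes the graph side: vertices are points and edges are arcs of the plane from the
  start, so that a network carries its drawing with it. Names in the natural numbers come only at
  the end.\<close>

inductive sp_resistance :: "real \<Rightarrow> nat \<Rightarrow> bool" where
  unit: "sp_resistance 1 1"
| ser: "sp_resistance x m \<Longrightarrow> sp_resistance y n \<Longrightarrow> sp_resistance (x + y) (m + n)"
| par: "sp_resistance x m \<Longrightarrow> sp_resistance y n \<Longrightarrow> sp_resistance (1 / (1 / x + 1 / y)) (m + n)"
| weaken: "sp_resistance x m \<Longrightarrow> m \<le> n \<Longrightarrow> sp_resistance x n"

lemma sp_resistance_pos: "sp_resistance x n \<Longrightarrow> x > 0"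
  by (induction rule: sp_resistance.induct) (auto intro: add_pos_pos)

text \<open>Exchanging series and parallel composition inverts the resistance at the same cost,
  since \<open>par\<close> is addition of reciprocals.\<close>

lemma sp_resistance_inverse: "sp_resistance x n \<Longrightarrow> sp_resistance (1 / x) n"
proof (induction rule: sp_resistance.induct)
  case unit
  then show ?case using sp_resistance.unit by simp
next
  case (ser x m y n)
  then have "sp_resistance (1 / (1 / (1 / x) + 1 / (1 / y))) (m + n)" by (blast intro: sp_resistance.par)
  then show ?case by simp
next
  case (par x m y n)
  then have "sp_resistance (1 / x + 1 / y) (m + n)" by (blast intro: sp_resistance.ser)
  then show ?case by simp
next
  case (weaken x m n)
  then show ?case using sp_resistance.weaken by blast
qed

lemma sp_resistance_add_nat:
  assumes "sp_resistance x n"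
  shows "sp_resistance (real k + x) (k + n)"
proof (induction k)
  case 0
  then show ?case using assms by simp
next
  case (Suc k)
  then have "sp_resistance (1 + (real k + x)) (1 + (k + n))" by (blast intro: sp_resistance.ser sp_resistance.unit)
  then show ?case by (simp add: algebra_simps)
qed

section \<open>The gadget that magnifies by 4\<close>

lemma sp_resistance_half: "sp_resistance (1 / 2) 2"
  using sp_resistance.par[OF sp_resistance.unit sp_resistance.unit] by (simp add: numeral_2_eq_2)

text \<open>The gadget puts a unit in parallel with x and 1/2 in series, so x becomes 1/2 + x / (1 +
  x). This Moebius map fixes 1 with derivative 1/4; in the coordinate
  \<open>a = 1 / (1 - x)\<close>, which sends 1 to infinity, it is affine with slope 4.\<close>

lemma sp_resistance_magnify:
  assumes "sp_resistance (1 - 1 / a) n" "a > 1"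
  shows "sp_resistance (1 - 1 / (4 * a - 2)) (n + 3)"
proof -
  have "sp_resistance (1 + 1 / (1 - 1 / a)) (1 + n)"
    by (intro sp_resistance.ser sp_resistance.unit sp_resistance_inverse assms(1))
  then have "sp_resistance (1 / 2 + 1 / (1 + 1 / (1 - 1 / a))) (2 + (1 + n))"
    using sp_resistance.ser[OF sp_resistance_half sp_resistance_inverse] by blast
  moreover have "1 / 2 + 1 / (1 + 1 / (1 - 1 / a)) = 1 - 1 / (4 * a - 2)"
  proof -
    have "1 + 1 / (1 - 1 / a) = (2 * a - 1) / (a - 1)" using assms(2) by (simp add: field_simps)
    then show ?thesis using assms(2) by (simp add: divide_simps; simp add: algebra_simps)
  qed
  ultimately show ?thesis by (simp add: eval_nat_numeral)
qed

text \<open>The number 2/3 is the fixed point of \<open>a\<close> \<mapsto>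
  \<open>4 * a - 2\<close>. The iteration starts at \<open>a = z + 1\<close>, the coordinate of z in
  parallel with a unit, whence \<open>z + 1 - 2 / 3 = z + 1 / 3\<close>.\<close>

lemma sp_resistance_magnify_iterated:
  assumes "sp_resistance z n"
  shows "sp_resistance (1 - 1 / (4 ^ J * (z + 1 / 3) + 2 / 3)) (n + 3 * J + 1)"
proof (induction J)
  case 0
  have z: "z > 0" using sp_resistance_pos[OF assms] .
  have "1 / (1 / z + 1 / 1) = 1 - 1 / (z + 1)" using z by (simp add: field_simps)
  then have "sp_resistance (1 - 1 / (z + 1)) (n + 1)"
    using sp_resistance.par[OF assms sp_resistance.unit] by metis
  moreover have "4 ^ 0 * (z + 1 / 3) + 2 / 3 = z + 1" by simp
  ultimately show ?case by (simp add: add.commute)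
next
  case (Suc J)
  have z: "z > 0" using sp_resistance_pos[OF assms] .
  have "z + 1 / 3 \<le> 4 ^ J * (z + 1 / 3)" using mult_right_mono[of 1 "4 ^ J" "z + 1 / 3"] z by simp
  moreover have "1 / 3 < z + 1 / 3" using z by simp
  ultimately have "1 / 3 < 4 ^ J * (z + 1 / 3)" by (rule less_le_trans[rotated])
  then have "4 ^ J * (z + 1 / 3) + 2 / 3 > 1" using add_strict_right_mono[of "1 / 3" _ "2 / 3 :: real"] by fastforce
  from sp_resistance_magnify[OF Suc this]
  show ?case by (simp add: algebra_simps)
qed

text \<open>If \<open>y = k / (2 * 4 ^ J)\<close> then \<open>(2 - y) / 4 = (4 * 4 ^ J - k) / (2 * 4 ^ Suc J)\<close>. On the ratio
  \<open>(1 - y) / y\<close> this map costs three resistors, and complementing the digits inverts the ratio. Iterating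
  it from \<open>y = 1 / 2\<close>, the reachable numerators are the following.\<close>

fun dyadic_digits :: "(nat \<Rightarrow> nat) \<Rightarrow> nat \<Rightarrow> nat" where
  "dyadic_digits b 0 = 1"
| "dyadic_digits b (Suc J) = dyadic_digits b J + 2 * 4 ^ J * (1 + b J)"

lemma dyadic_digits_pos: "0 < dyadic_digits b J"
  by (induction J) auto

text \<open>At each place the two digits, 1 or 2, add up to 3, and 2 + 6 * (1 + 4 + ...) telescopes.
  In terms of y = \<open>dyadic_digits b J / (2 * 4 ^ J)\<close> this is the reflection y \<mapsto>
  1 - y.\<close>

lemma dyadic_digits_complement:
  assumes "\<And>i. b i \<le> 1"
  shows "dyadic_digits (\<lambda>i. 1 - b i) J + dyadic_digits b J = 2 * 4 ^ J"
proof (induction J)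
  case (Suc J)
  have "b J = 0 \<or> b J = 1" using assms[of J] by auto
  then show ?case using Suc by auto
qed auto

lemma sp_resistance_dyadic_ratio:
  assumes "\<And>i. b i \<le> 1"
  shows "sp_resistance (real (2 * 4 ^ J) / real (dyadic_digits b J) - 1) (3 * J + 1)"
  using assms
proof (induction J arbitrary: b)
  case 0
  then show ?case using sp_resistance.unit by simp
next
  case (Suc J)
  \<comment> \<open>A top digit \<open>1 + b J = 1\<close> arises from the map (2 - y) / 4 applied
    to the complemented lower digits. A top digit 2 is reduced to this case by complementing all
    digits, which inverts the ratio.\<close>
  have *: "sp_resistance (real (2 * 4 ^ Suc J) / real (dyadic_digits b (Suc J)) - 1) (3 * Suc J + 1)"
    if b: "\<And>i. b i \<le> 1" and b0: "b J = 0" for b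
  proof -
    define m where "m = real (dyadic_digits b J)"
    define c where "c = real (4 ^ J)"
    define k where "k = real (dyadic_digits (\<lambda>i. 1 - b i) J)"
    have km: "k + m = 2 * c"
      using dyadic_digits_complement[of b J, OF b] unfolding k_def m_def c_def
      by (metis of_nat_add of_nat_mult of_nat_numeral)
    have k: "k > 0" using dyadic_digits_pos unfolding k_def by simp
    have m: "m > 0" using dyadic_digits_pos unfolding m_def by simp
    have c: "c > 0" unfolding c_def by simp
    have "sp_resistance (2 * c / k - 1) (3 * J + 1)"
      using Suc.IH[of "\<lambda>i. 1 - b i"] unfolding c_def k_def by simp
    then have "sp_resistance (1 + 1 / (1 / 2 + (2 * c / k - 1))) (1 + (2 + (3 * J + 1)))"
      by (intro sp_resistance.ser sp_resistance.unit sp_resistance_inverse sp_resistance_half)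
    moreover have "real (2 * 4 ^ Suc J) / real (dyadic_digits b (Suc J)) - 1 = 8 * c / (m + 2 * c) - 1"
      using b0 by (simp add: m_def c_def)
    moreover have "1 + 1 / (1 / 2 + (2 * c / k - 1)) = 8 * c / (m + 2 * c) - 1"
    proof -
      have c': "c = (k + m) / 2" using km by simp
      have "1 / 2 + (2 * c / k - 1) = (k + 2 * m) / (2 * k)" using k unfolding c' by (simp add: field_simps)
      then show ?thesis using k m unfolding c' by (simp add: divide_simps; simp add: algebra_simps)
    qed
    moreover have "1 + (2 + (3 * J + 1)) = 3 * Suc J + 1" by simp
    ultimately show ?thesis by (simp only:)
  qed
  show ?case
  proof (cases "b J = 0")
    case True
    then show ?thesis using *[of b] Suc.prems by blast
  next
    case False
    let ?b = "\<lambda>i. 1 - b i"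
    let ?m = "real (dyadic_digits b (Suc J))" and ?k = "real (dyadic_digits ?b (Suc J))"
    have s: "?k + ?m = real (2 * 4 ^ Suc J)"
      using dyadic_digits_complement[of b "Suc J", OF Suc.prems] by (metis of_nat_add)
    have k: "?k > 0" by (simp only: of_nat_0_less_iff dyadic_digits_pos)
    have m: "?m > 0" by (simp only: of_nat_0_less_iff dyadic_digits_pos)
    have "sp_resistance (1 / (real (2 * 4 ^ Suc J) / ?k - 1)) (3 * Suc J + 1)"
      using False by (intro sp_resistance_inverse *) auto
    moreover have "1 / ((?k + ?m) / ?k - 1) = (?k + ?m) / ?m - 1"
      using k m by (simp add: field_simps)
    ultimately show ?thesis unfolding s by simp
  qed
qed

lemma sp_resistance_dyadic_digits:
  assumes "\<And>i. b i \<le> 1"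
  shows "sp_resistance (real (dyadic_digits b J) / real (2 * 4 ^ J)) (3 * J + 2)"
proof -
  have "sp_resistance (1 / (1 + (real (2 * 4 ^ J) / real (dyadic_digits b J) - 1))) (1 + (3 * J + 1))"
    using assms by (intro sp_resistance.ser sp_resistance.unit sp_resistance_inverse sp_resistance_dyadic_ratio)
  then show ?thesis by simp
qed

text \<open>A digit of one summand is 1 plus a bit, and three bits can add up to any base-4 digit 0,
  1, 2, 3; this is why three summands are taken. The offset \<open>1 + 2 * 4 ^ J\<close> is the sum
  when all bits are 0.\<close>

lemma three_dyadic_digits:
  "r < 4 ^ J \<Longrightarrow> \<exists>b b' b''. (\<forall>i. b i \<le> 1 \<and> b' i \<le> 1 \<and> b'' i \<le> 1) \<and>
     dyadic_digits b J + dyadic_digits b' J + dyadic_digits b'' J = 1 + 2 * 4 ^ J + 2 * r"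
proof (induction J arbitrary: r)
  case 0
  then show ?case by (auto intro!: exI[of _ "\<lambda>_. 0"])
next
  case (Suc J)
  define d where "d = r div 4 ^ J"
  have d: "d < 4" unfolding d_def using Suc.prems by (simp add: less_mult_imp_div_less)
  have r: "r = r mod 4 ^ J + d * 4 ^ J" unfolding d_def by (rule mod_div_mult_eq[symmetric])
  obtain b b' b'' where b: "\<forall>i. b i \<le> 1 \<and> b' i \<le> 1 \<and> b'' i \<le> 1"
    "dyadic_digits b J + dyadic_digits b' J + dyadic_digits b'' J = 1 + 2 * 4 ^ J + 2 * (r mod 4 ^ J)"
    using Suc.IH[of "r mod 4 ^ J"] by auto
  have upd: "dyadic_digits (f(J := x)) n = dyadic_digits f n" if "n \<le> J" for f x n
    using that by (induction n) auto
  obtain x x' x'' where x: "x \<le> 1" "x' \<le> 1" "x'' \<le> 1" "x + x' + x'' = d"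
  proof -
    have "d = 0 \<or> d = 1 \<or> d = 2 \<or> d = 3" using d by auto
    then show ?thesis
      using that[of 0 0 0] that[of 1 0 0] that[of 1 1 0] that[of 1 1 1] by auto
  qed
  have "dyadic_digits (b(J := x)) (Suc J) + dyadic_digits (b'(J := x')) (Suc J) + dyadic_digits (b''(J := x'')) (Suc J)
      = 1 + 2 * 4 ^ J + 2 * (r mod 4 ^ J) + 2 * 4 ^ J * (3 + (x + x' + x''))"
    using b(2) upd[of J] by (simp add: algebra_simps)
  also have "\<dots> = 1 + 2 * 4 ^ Suc J + 2 * r"
    unfolding x(4) by (subst (2) r) (simp add: algebra_simps)
  finally have "dyadic_digits (b(J := x)) (Suc J) + dyadic_digits (b'(J := x')) (Suc J) + dyadic_digits (b''(J := x'')) (Suc J)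
      = 1 + 2 * 4 ^ Suc J + 2 * r" .
  moreover have "\<forall>i. (b(J := x)) i \<le> 1 \<and> (b'(J := x')) i \<le> 1 \<and> (b''(J := x'')) i \<le> 1" using b(1) x by simp
  ultimately show ?case by blast
qed

lemma sp_resistance_odd_dyadic:
  assumes "4 ^ J \<le> M"
  shows "sp_resistance (real (2 * M + 1) / real (2 * 4 ^ J)) (9 * J + 6 + M div 4 ^ J)"
proof -
  define r where "r = M mod 4 ^ J"
  \<comment> \<open>The three dyadic numbers already add up to 1 + (2 r + 1) / (2 * 4^J), so one
    unit fewer is put in series.\<close>
  define k where "k = M div 4 ^ J - 1"
  have "M div 4 ^ J \<ge> 1" using assms by (simp add: div_greater_zero_iff Suc_le_eq)
  then have k: "M div 4 ^ J = k + 1" unfolding k_def by simp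
  have M: "M = r + (k + 1) * 4 ^ J" unfolding r_def k[symmetric] by (rule mod_div_mult_eq[symmetric])
  obtain b b' b'' where b: "\<forall>i. b i \<le> 1 \<and> b' i \<le> 1 \<and> b'' i \<le> 1"
    "dyadic_digits b J + dyadic_digits b' J + dyadic_digits b'' J = 1 + 2 * 4 ^ J + 2 * r"
    using three_dyadic_digits[of r J] unfolding r_def by auto
  let ?D = "real (2 * 4 ^ J)"
  have "sp_resistance (real k + (real (dyadic_digits b J) / ?D + (real (dyadic_digits b' J) / ?D + real (dyadic_digits b'' J) / ?D)))
     (k + ((3 * J + 2) + ((3 * J + 2) + (3 * J + 2))))"
    using b(1) by (intro sp_resistance_add_nat sp_resistance.ser sp_resistance_dyadic_digits) auto
  moreover have "real (dyadic_digits b J) / ?D + (real (dyadic_digits b' J) / ?D + real (dyadic_digits b'' J) / ?D)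
     = real (1 + 2 * 4 ^ J + 2 * r) / ?D"
    unfolding b(2)[symmetric] by (simp add: add_divide_distrib)
  moreover have "real k + real (1 + 2 * 4 ^ J + 2 * r) / ?D = real (2 * M + 1) / ?D"
    unfolding M by (simp add: field_simps)
  ultimately have "sp_resistance (real (2 * M + 1) / ?D) (k + ((3 * J + 2) + ((3 * J + 2) + (3 * J + 2))))"
    by simp
  then show ?thesis by (rule sp_resistance.weaken) (use k in simp)
qed

text \<open>The map \<open>x \<mapsto> 1 + 1 / x\<close> preserves \<open>[1, 2]\<close> and contracts by a factor of at most 4 there;
  inverting it is one step of the Euclidean algorithm with partial quotient 1.\<close>

lemma interval_of_unit_quotients:
  "\<exists>l h::real. 1 \<le> l \<and> h \<le> 2 \<and> h - l \<ge> 1 / 4 ^ j \<and>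
     (\<forall>P Q::nat. Q > 0 \<longrightarrow> l \<le> real P / real Q \<longrightarrow> real P / real Q \<le> h \<longrightarrow>
        (\<exists>u v::nat. v > 0 \<and> v \<le> u \<and> u \<le> 2 * v \<and> real (u + v) \<le> (2 / 3) ^ j * real (P + Q) \<and>
           (\<forall>n. sp_resistance (real u / real v) n \<longrightarrow> sp_resistance (real P / real Q) (n + j))))"
proof (induction j)
  case 0
  have "\<exists>u v::nat. v > 0 \<and> v \<le> u \<and> u \<le> 2 * v \<and> real (u + v) \<le> (2 / 3) ^ 0 * real (P + Q) \<and>
           (\<forall>n. sp_resistance (real u / real v) n \<longrightarrow> sp_resistance (real P / real Q) (n + 0))"
    if "Q > 0" "1 \<le> real P / real Q" "real P / real Q \<le> 2" for P Q :: nat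
    using that by (intro exI[of _ P] exI[of _ Q]) (auto simp: field_simps)
  then show ?case by (intro exI[of _ 1] exI[of _ 2]) auto
next
  case (Suc j)
  then obtain l h :: real where lh: "1 \<le> l" "h \<le> 2" "h - l \<ge> 1 / 4 ^ j"
    and IH: "\<And>P Q::nat. Q > 0 \<Longrightarrow> l \<le> real P / real Q \<Longrightarrow> real P / real Q \<le> h \<Longrightarrow>
        (\<exists>u v::nat. v > 0 \<and> v \<le> u \<and> u \<le> 2 * v \<and> real (u + v) \<le> (2 / 3) ^ j * real (P + Q) \<and>
           (\<forall>n. sp_resistance (real u / real v) n \<longrightarrow> sp_resistance (real P / real Q) (n + j)))"
    by blast
  have "0 < 1 / (4::real) ^ j" by simp
  then have h: "1 < h" "l < h" using lh by linarith+
  have len: "(1 + 1 / l) - (1 + 1 / h) \<ge> 1 / 4 ^ Suc j"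
  proof -
    have "l * h \<le> 2 * 2" using lh h by (intro mult_mono) auto
    then have "(h - l) / 4 \<le> (h - l) / (l * h)" using lh h by (intro divide_left_mono) auto
    also have "\<dots> = (1 + 1 / l) - (1 + 1 / h)" using lh h by (simp add: field_simps)
    finally show ?thesis using lh(3) by simp
  qed
  have step: "\<exists>u v::nat. v > 0 \<and> v \<le> u \<and> u \<le> 2 * v \<and> real (u + v) \<le> (2 / 3) ^ Suc j * real (P + Q) \<and>
           (\<forall>n. sp_resistance (real u / real v) n \<longrightarrow> sp_resistance (real P / real Q) (n + Suc j))"
    if Q: "Q > 0" and P: "1 + 1 / h \<le> real P / real Q" "real P / real Q \<le> 1 + 1 / l" for P Q :: nat
  proof -
    have "0 < 1 / h" using h by simp
    then have "1 < real P / real Q" using P(1) by linarith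
    then have PQ: "Q < P" using Q by (simp add: field_simps)
    define R where "R = P - Q"
    have R: "R > 0" "P = Q + R" using PQ unfolding R_def by auto
    have e: "real P / real Q = 1 + real R / real Q" using Q unfolding R(2) by (simp add: field_simps)
    have "1 / h \<le> real R / real Q" "real R / real Q \<le> 1 / l" using P unfolding e by auto
    then have "real Q / real R \<le> h" "l \<le> real Q / real R" using R(1) Q h lh by (auto simp: field_simps)
    from IH[OF R(1) this(2,1)] obtain u v :: nat where uv: "v > 0" "v \<le> u" "u \<le> 2 * v"
      "real (u + v) \<le> (2 / 3) ^ j * real (Q + R)"
      "\<And>n. sp_resistance (real u / real v) n \<Longrightarrow> sp_resistance (real Q / real R) (n + j)" by blast
    have "1 / l \<le> 1" using lh by simp
    then have "real P / real Q \<le> 2" using P(2) by linarith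
    then have "P \<le> 2 * Q" using Q by (simp add: field_simps)
    \<comment> \<open>\<open>Q + R\<close> is \<open>P\<close>, and \<open>P \<le> 2 * Q\<close>
      makes it at most two thirds of \<open>P + Q\<close>.\<close>
    then have "real (Q + R) \<le> (2 / 3) * real (P + Q)" unfolding R(2) by simp
    then have "(2 / 3) ^ j * real (Q + R) \<le> (2 / 3) ^ j * ((2 / 3) * real (P + Q))" by (intro mult_left_mono) auto
    with uv(4) have "real (u + v) \<le> (2 / 3) ^ j * ((2 / 3) * real (P + Q))" by (rule order_trans)
    then have "real (u + v) \<le> (2 / 3) ^ Suc j * real (P + Q)" by (simp only: power_Suc mult.assoc mult.left_commute)
    moreover have "sp_resistance (real P / real Q) (n + Suc j)" if "sp_resistance (real u / real v) n" for n
    proof -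
      have "sp_resistance (1 + 1 / (real Q / real R)) (1 + (n + j))"
        using uv(5)[OF that] by (intro sp_resistance.ser sp_resistance.unit sp_resistance_inverse)
      then show ?thesis unfolding e by simp
    qed
    ultimately show ?thesis using uv(1-3) by blast
  qed
  have "1 \<le> 1 + 1 / h" "1 + 1 / l \<le> 2" using lh h by auto
  then show ?case using len step by blast
qed


text \<open>For \<open>\<alpha> = p / e\<close> one has \<open>q / p = 1 - 1 / \<alpha>\<close>, which magnification builds from \<open>z\<close>. Now \<open>z\<close> has
  denominator \<open>3 * 4 ^ J * e\<close> at first sight, but \<open>4 ^ J + 2\<close> is divisible by 3, so \<open>4 ^ J * e\<close> suffices.
  Subtracting a dyadic number therefore merely doubles the denominator, and it can be chosen so that the next
  \<open>J\<close> partial quotients are all 1; those \<open>J\<close> Euclidean steps then pay for the \<open>O(J)\<close> resistors spent.\<close>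

lemma sp_resistance_large_quotient:
  fixes p q e J :: nat
  assumes pq: "p = q + e" "e > 0" "q > 0" and J: "J \<ge> 3"
    and z: "z = real p / (4 ^ J * real e) - 1 / 3 - 2 / (3 * 4 ^ J)" "3 \<le> z" "z < 13"
  shows "\<exists>u v::nat. v > 0 \<and> v \<le> u \<and> u \<le> 2 * v \<and> real (u + v) \<le> (2 / 3) ^ (J - 2) * real (p + q) \<and>
     (\<forall>n. sp_resistance (real u / real v) n \<longrightarrow> sp_resistance (real p / real q) (n + 13 * J + 19))"
proof -
  obtain l h :: real where lh: "1 \<le> l" "h \<le> 2" "h - l \<ge> 1 / 4 ^ J"
    and I: "\<And>P Q::nat. Q > 0 \<Longrightarrow> l \<le> real P / real Q \<Longrightarrow> real P / real Q \<le> h \<Longrightarrow>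
        (\<exists>u v::nat. v > 0 \<and> v \<le> u \<and> u \<le> 2 * v \<and> real (u + v) \<le> (2 / 3) ^ J * real (P + Q) \<and>
           (\<forall>n. sp_resistance (real u / real v) n \<longrightarrow> sp_resistance (real P / real Q) (n + J)))"
    using interval_of_unit_quotients[of J] by blast
  define c :: real where "c = 4 ^ J"
  have c: "c > 0" "c \<ge> 1" unfolding c_def by auto
  have "(1::real) / 4 ^ J > 0" by simp
  then have h: "1 < h" "l < h" using lh by linarith+
  \<comment> \<open>\<open>d\<close> below is the dyadic number to subtract; it lies in \<open>[z - h, z - l]\<close>.\<close>
  define x where "x = (c * (z - l) * 2 - 1) / 2"
  define M where "M = nat \<lfloor>x\<rfloor>"
  have "c * (z - l) \<ge> 1 * 1" using c z lh h by (intro mult_mono) auto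
  then have x0: "x \<ge> 0" unfolding x_def by simp
  have M: "real M \<le> x" "x < real M + 1" unfolding M_def using x0 by linarith+
  define d where "d = real (2 * M + 1) / (2 * c)"
  have dl: "d \<le> z - l"
    using M(1) c unfolding d_def x_def by (simp add: field_simps)
  \<comment> \<open>The candidates for d are 1/c apart and the interval from z - h to z - l has
    length at least 1/c. Hence the largest candidate below z - l, which is d by the choice of M,
    cannot lie below z - h.\<close>
  have dh: "z - h \<le> d"
  proof -
    have "c * (h - l) \<ge> 1" using lh(3) c unfolding c_def by (simp add: field_simps)
    moreover have "c * (z - l) < real M + 3 / 2" using M(2) unfolding x_def by simp
    ultimately have "c * (z - h) \<le> real M + 1 / 2" by (simp add: algebra_simps)
    then show ?thesis using c unfolding d_def by (simp add: field_simps)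
  qed
  \<comment> \<open>Since h \<le> 2, the bound 3 \<le> z leaves d \<ge> 1, the range that
    \<open>sp_resistance_odd_dyadic\<close> covers.\<close>
  have Mc: "4 ^ J \<le> M"
  proof -
    have "1 \<le> d" using dh z lh by linarith
    then have "c \<le> real M + 1 / 2" using c unfolding d_def by (simp add: field_simps)
    then have "real (4 ^ J) < real (M + 1)" unfolding c_def by simp
    then have "4 ^ J < M + 1" by (simp only: of_nat_less_iff)
    then show ?thesis by simp
  qed
  have Md: "M div 4 ^ J \<le> 12"
  proof -
    have "d < 12" using dl z lh by linarith
    then have "real M < 13 * c" using c unfolding d_def by (simp add: field_simps)
    then have "real M < real (13 * 4 ^ J)" unfolding c_def by simp
    then have "M < 13 * 4 ^ J" by (simp only: of_nat_less_iff)
    then have "M div 4 ^ J < 13" by (simp add: less_mult_imp_div_less)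
    then show ?thesis by simp
  qed
  have "d > 0" using c unfolding d_def by simp
  obtain k where k: "3 * k = 4 ^ J + (2::nat)"
  proof -
    have "\<exists>k. 3 * k = 4 ^ J + (2::nat)"
    proof (induction J)
      case 0 show ?case by (intro exI[of _ 1]) simp
    next
      case (Suc J)
      then obtain k where "3 * k = 4 ^ J + (2::nat)" by blast
      then have "3 * (4 * k - 2) = 4 ^ Suc J + (2::nat)" by simp
      then show ?case by blast
    qed
    then show ?thesis using that by blast
  qed
  have kc: "real k = (c + 2) / 3" using arg_cong[OF k, of real] unfolding c_def by simp
  define Q where "Q = 2 * 4 ^ J * e"
  have Q: "Q > 0" "real Q = 2 * c * real e" unfolding Q_def c_def using pq by auto
  have e: "real e > 0" using pq by simp
  have zQ: "z = (2 * real p - 2 * real k * real e) / real Q"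
    unfolding z(1) kc Q(2) c_def[symmetric] using c e by (simp add: field_simps)
  have dQ: "d = real ((2 * M + 1) * e) / real Q" unfolding d_def Q(2) using c e by (simp add: field_simps)
  \<comment> \<open>The truncated subtraction is exact because z - d is nonnegative, which the
    following lines derive from z - d \<ge> l.\<close>
  define P where "P = 2 * p - 2 * k * e - (2 * M + 1) * e"
  have zd: "z - d = (real (2 * p) - real (2 * k * e) - real ((2 * M + 1) * e)) / real Q"
    unfolding zQ dQ by (simp add: diff_divide_distrib)
  have zd1: "z - d \<ge> l" "z - d \<le> h" using dl dh by linarith+
  then have "0 \<le> z - d" using lh by linarith
  then have "0 \<le> real (2 * p) - real (2 * k * e) - real ((2 * M + 1) * e)"
    unfolding zd using Q(1) by (simp add: zero_le_divide_iff)
  then have "real (2 * k * e + (2 * M + 1) * e) \<le> real (2 * p)" unfolding of_nat_add by linarith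
  then have "2 * k * e + (2 * M + 1) * e \<le> 2 * p" by (simp only: of_nat_le_iff)
  then have "2 * p = P + 2 * k * e + (2 * M + 1) * e" unfolding P_def by linarith
  then have "real (2 * p) = real P + real (2 * k * e) + real ((2 * M + 1) * e)" by (metis of_nat_add)
  then have PQ: "real P / real Q = z - d" unfolding zd by simp
  obtain u v :: nat where uv: "v > 0" "v \<le> u" "u \<le> 2 * v" "real (u + v) \<le> (2 / 3) ^ J * real (P + Q)"
    "\<And>n. sp_resistance (real u / real v) n \<Longrightarrow> sp_resistance (real P / real Q) (n + J)"
    using I[OF Q(1), of P] zd1 unfolding PQ by blast
  have alpha: "4 ^ J * (z + 1 / 3) + 2 / 3 = real p / real e"
    unfolding z(1) c_def[symmetric] using c e by (simp add: field_simps)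
  \<comment> \<open>The cost splits into J for the unit quotients, at most 9 J + 18 for d, and 3 J +
    1 for the magnification.\<close>
  have cost: "sp_resistance (real p / real q) (n + 13 * J + 19)" if n: "sp_resistance (real u / real v) n" for n
  proof -
    have "sp_resistance d (9 * J + 6 + M div 4 ^ J)"
      using sp_resistance_odd_dyadic[OF Mc] unfolding d_def c_def by simp
    then have "sp_resistance ((z - d) + d) ((n + J) + (9 * J + 6 + M div 4 ^ J))"
      using sp_resistance.ser uv(5)[OF n] unfolding PQ by blast
    then have "sp_resistance z (n + 10 * J + 18)"
      using Md by (auto intro: sp_resistance.weaken)
    then have "sp_resistance (1 - 1 / (real p / real e)) ((n + 10 * J + 18) + 3 * J + 1)"
      using sp_resistance_magnify_iterated unfolding alpha[symmetric] by blast
    then have "sp_resistance (1 / (1 - 1 / (real p / real e))) (n + 13 * J + 19)"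
      using sp_resistance_inverse by (fastforce simp: algebra_simps)
    moreover have "1 / (1 - 1 / (real p / real e)) = real p / real q"
      using pq by (simp add: field_simps)
    ultimately show ?thesis by simp
  qed
  \<comment> \<open>P + Q \<le> 3 Q \<le> z Q \<le> 2 p. The factor 2 is rounded up to (3/2)^2 so
    that it uses up two of the J contractions by 2/3; this is the source of the exponent
    \<open>J - 2\<close>.\<close>
  have "real (P + Q) \<le> (3 / 2) ^ 2 * real (p + q)"
  proof -
    have "real P / real Q \<le> 2" using PQ zd1 lh by linarith
    then have 1: "real P \<le> 2 * real Q" using Q(1) by (simp add: field_simps)
    have "real k * real e \<ge> 0" by simp
    moreover have "z * real Q = 2 * real p - 2 * real k * real e" using zQ Q(1) by simp
    moreover have "3 * real Q \<le> z * real Q" using z by (intro mult_right_mono) auto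
    ultimately have "3 * real Q \<le> 2 * real p" by linarith
    then show ?thesis using 1 by (simp add: power2_eq_square)
  qed
  then have "(2 / 3) ^ J * real (P + Q) \<le> (2 / 3) ^ J * ((3 / 2) ^ 2 * real (p + q))" by (intro mult_left_mono) auto
  also have "\<dots> = (2 / 3) ^ (J - 2) * real (p + q)"
  proof -
    obtain i where "J = i + 2" using J by (metis add.commute le_add_diff_inverse2 add_leD2 numeral_3_eq_3 numeral_2_eq_2 Suc_leD)
    then show ?thesis by (simp add: power_add power2_eq_square)
  qed
  finally have "real (u + v) \<le> (2 / 3) ^ (J - 2) * real (p + q)" using uv(4) by (rule order_trans[rotated])
  then show ?thesis using uv(1-3) cost by blast
qed

section \<open>Euclidean descent with a logarithmic potential\<close>

text \<open>The potential is \<open>log (3 / 2) (p + q)\<close>: a reduction that shrinks the sum by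
  \<open>(2 / 3) ^ j\<close> lowers it by j and may spend \<open>215 * j\<close> resistors. A small
  quotient spends fewer than 213 with j = 1, a large one spends \<open>13 * J + 19\<close> with j =
  \<open>J - 2\<close>. Keeping p / q between 1 and 2 is the invariant that every reduction
  restores.\<close>

lemma sp_resistance_log_bound:
  fixes p q :: nat
  assumes "q > 0" "q \<le> p" "p \<le> 2 * q"
  shows "\<exists>n. sp_resistance (real p / real q) n \<and> real n \<le> 215 * log (3 / 2) (real (p + q))"
  using assms
proof (induction "p + q" arbitrary: p q rule: less_induct)
  case less
  define e where "e = p - q"
  have e: "p = q + e" unfolding e_def using less.prems by simp
  have reduce: ?case if uv: "v > 0" "v \<le> u" "u \<le> 2 * v" and j: "j > 0"
      and le: "real (u + v) \<le> (2 / 3) ^ j * real (p + q)"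
      and sp: "\<And>n. sp_resistance (real u / real v) n \<Longrightarrow> sp_resistance (real p / real q) (n + m)" and m: "m \<le> 215 * j"
    for u v j m :: nat
  proof -
    have pos: "real (u + v) > 0" using uv by simp
    have "(2 / 3 :: real) ^ j < 1" using j by (simp add: power_less_one_iff)
    moreover have pq: "real (p + q) > 0" using less.prems by simp
    ultimately have "(2 / 3) ^ j * real (p + q) < 1 * real (p + q)" by (intro mult_strict_right_mono) auto
    with le have "real (u + v) < 1 * real (p + q)" by (rule le_less_trans)
    then have "u + v < p + q" by simp
    from less.hyps[OF this uv] obtain n where n: "sp_resistance (real u / real v) n"
      "real n \<le> 215 * log (3 / 2) (real (u + v))" by blast
    have "log (3 / 2) (real (u + v)) \<le> log (3 / 2) ((2 / 3) ^ j * real (p + q))"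
      using pos le by (subst log_le_cancel_iff) (auto intro: less_le_trans)
    also have "\<dots> = log (3 / 2) (real (p + q)) - real j"
    proof -
      have "(2 / 3) ^ j * real (p + q) = real (p + q) / (3 / 2) ^ j" by (simp add: power_divide field_simps)
      then show ?thesis using pq by (simp add: log_divide log_nat_power)
    qed
    finally have "real (n + m) \<le> 215 * log (3 / 2) (real (p + q))" using n(2) m by simp
    then show ?thesis using sp[OF n(1)] by blast
  qed
  \<comment> \<open>214 = 4^3 * (3 + 1/3) + 2/3 is the least p / e for which J = 3 magnifications
    still leave z \<ge> 3. With J \<ge> 3 the gain \<open>J - 2\<close> is positive.\<close>
  consider "e = 0" | "e > 0" "p < 214 * e" | "e > 0" "214 * e \<le> p" by linarith
  then show ?case
  proof cases
    case 1
    have "log (3 / 2) (3 / 2) \<le> log (3 / 2) (real (p + q))"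
      using less.prems by (subst log_le_cancel_iff) auto
    then have "1 \<le> 215 * log (3 / 2) (real (p + q))" by simp
    then show ?thesis using 1 e less.prems sp_resistance.unit by (intro exI[of _ 1]) simp
  next
    case 2
    \<comment> \<open>One less than the quotient, so that f / e = 1 + (q mod e) / e stays between 1
      and 2.\<close>
    define k where "k = q div e - 1"
    have "q div e \<ge> 1" using 2 e less.prems by (simp add: div_greater_zero_iff Suc_le_eq)
    then have k: "q div e = k + 1" unfolding k_def by simp
    define f where "f = q - k * e"
    have q: "q = k * e + e + q mod e" using div_mult_mod_eq[of q e] unfolding k by simp
    then have f: "f = e + q mod e" unfolding f_def by simp
    have "(k + 1) * e \<le> q" using q by simp
    then have "(k + 1) * e < 213 * e" using 2 e by linarith
    then have k213: "k + 1 < 213" using 2 by simp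
    have fe: "e \<le> f" "f \<le> 2 * e" "f \<le> q" using f 2 unfolding f_def by (auto intro: less_imp_le)
    show ?thesis
    proof (rule reduce[of e f 1 "k + 1"])
      have "3 * real f + 3 * real e \<le> 2 * real (p + q)" using fe e by simp
      then show "real (f + e) \<le> (2 / 3) ^ 1 * real (p + q)" by simp
      fix n assume n: "sp_resistance (real f / real e) n"
      have "sp_resistance (1 + 1 / (real k + real f / real e)) (1 + (k + n))"
        by (intro sp_resistance.ser sp_resistance.unit sp_resistance_inverse sp_resistance_add_nat n)
      moreover have "real k + real f / real e = real q / real e"
        using arg_cong[OF q, of real] f 2 by (simp add: field_simps)
      moreover have "1 + 1 / (real q / real e) = real p / real q" using e less.prems by (simp add: field_simps)
      ultimately show "sp_resistance (real p / real q) (n + (k + 1))" by (simp add: add.commute add.left_commute)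
    qed (use 2 fe k213 in auto)
  next
    case 3
    define \<zeta> where "\<zeta> = (\<lambda>J. real p / (4 ^ J * real e) - 1 / 3 - 2 / (3 * 4 ^ J))"
    have e0: "real e > 0" using 3 by simp
    have s: "\<zeta> J + 1 / 3 = 4 * (\<zeta> (Suc J) + 1 / 3)" for J unfolding \<zeta>_def using e0 by (simp add: field_simps)
    have z3: "\<zeta> 3 \<ge> 3"
    proof -
      have "real p \<ge> 214 * real e" using 3 by (metis of_nat_le_iff of_nat_mult of_nat_numeral)
      then show ?thesis unfolding \<zeta>_def using e0 by (simp add: field_simps)
    qed
    \<comment> \<open>The last index before \<zeta> drops below 3. Each step divides \<zeta> + 1/3
      by 4, so at that index \<zeta> < 4 * (3 + 1/3) - 1/3 = 13.\<close>
    define J where "J = (LEAST J. J \<ge> 3 \<and> \<zeta> J < 3) - 1"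
    have "\<exists>J\<ge>3. \<zeta> J < 3"
    proof -
      obtain J where J: "real p / real e < 4 ^ J" using real_arch_pow[of 4] by auto
      also have "(4::real) ^ J \<le> 4 ^ (J + 3)" by (intro power_increasing) auto
      finally have "real p / (4 ^ (J + 3) * real e) < 1" using e0 by (simp add: field_simps)
      moreover have "0 < 2 / (3 * (4::real) ^ (J + 3))" by simp
      ultimately have "\<zeta> (J + 3) < 3" unfolding \<zeta>_def by linarith
      then show ?thesis by (intro exI[of _ "J + 3"]) auto
    qed
    then have L: "(LEAST J. J \<ge> 3 \<and> \<zeta> J < 3) \<ge> 3 \<and> \<zeta> (LEAST J. J \<ge> 3 \<and> \<zeta> J < 3) < 3"
      by (rule LeastI_ex)
    moreover have "(LEAST J. J \<ge> 3 \<and> \<zeta> J < 3) \<noteq> 3" using L z3 by auto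
    ultimately have J: "J \<ge> 3" "(LEAST J. J \<ge> 3 \<and> \<zeta> J < 3) = Suc J" unfolding J_def by auto
    have "\<not> (J \<ge> 3 \<and> \<zeta> J < 3)" using J(2) by (intro not_less_Least) simp
    then have z: "3 \<le> \<zeta> J" using J by auto
    have "\<zeta> J < 13" using s[of J] L J(2) by simp
    obtain u v :: nat where uv: "v > 0" "v \<le> u" "u \<le> 2 * v" "real (u + v) \<le> (2 / 3) ^ (J - 2) * real (p + q)"
      "\<And>n. sp_resistance (real u / real v) n \<Longrightarrow> sp_resistance (real p / real q) (n + 13 * J + 19)"
      using sp_resistance_large_quotient[OF e 3(1) less.prems(1) J(1) _ z(1)] \<open>\<zeta> J < 13\<close> unfolding \<zeta>_def by blast
    show ?thesis
      by (rule reduce[of v u "J - 2" "13 * J + 19"]) (use uv J in \<open>auto simp: add.assoc\<close>)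
  qed
qed

text \<open>The first partial quotient is paid for directly by unit resistors, which gives the
  \<open>max\<close> term; inversion covers p < q. One unit of the quotient is left over to bring
  the remaining ratio into the range from 1 to 2.\<close>

lemma sp_resistance_rational:
  fixes p q :: nat
  assumes "p > 0" "q > 0"
  shows "\<exists>n. sp_resistance (real p / real q) n \<and>
    real n \<le> max (real p / real q) (real q / real p) + 215 * log (3 / 2) (real (p + q))"
proof -
  have *: "\<exists>n. sp_resistance (real p / real q) n \<and> real n \<le> real p / real q + 215 * log (3 / 2) (real (p + q))"
    if pq: "q > 0" "q \<le> p" for p q :: nat
  proof -
    define k where "k = p div q - 1"
    have "p div q \<ge> 1" using pq by (simp add: div_greater_zero_iff Suc_le_eq)
    then have k: "p div q = k + 1" unfolding k_def by simp
    define f where "f = p - k * q"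
    have p: "p = k * q + q + p mod q" using div_mult_mod_eq[of p q] unfolding k by simp
    then have f: "f = q + p mod q" unfolding f_def by simp
    have kf: "k * q + f = p" using p f by simp
    have e: "real k + real f / real q = real p / real q" using arg_cong[OF kf, of real] pq by (simp add: field_simps)
    obtain n where n: "sp_resistance (real f / real q) n" "real n \<le> 215 * log (3 / 2) (real (f + q))"
      using sp_resistance_log_bound[of q f] f pq by (auto intro: less_imp_le)
    have "log (3 / 2) (real (f + q)) \<le> log (3 / 2) (real (p + q))"
      using pq kf f by (subst log_le_cancel_iff) auto
    moreover have "real k \<le> real p / real q" using e by (metis add.commute le_add_same_cancel2 of_nat_0_le_iff divide_nonneg_nonneg)
    ultimately have "real (k + n) \<le> real p / real q + 215 * log (3 / 2) (real (p + q))" using n(2) by simp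
    moreover have "sp_resistance (real p / real q) (k + n)" using sp_resistance_add_nat[OF n(1), of k] unfolding e .
    ultimately show ?thesis by blast
  qed
  show ?thesis
  proof (cases "q \<le> p")
    case True
    then show ?thesis using *[OF assms(2)] by fastforce
  next
    case False
    then obtain n where n: "sp_resistance (real q / real p) n" "real n \<le> real q / real p + 215 * log (3 / 2) (real (q + p))"
      using *[OF assms(1), of q] by auto
    have "sp_resistance (real p / real q) n" using sp_resistance_inverse[OF n(1)] by simp
    moreover have "real n \<le> max (real p / real q) (real q / real p) + 215 * log (3 / 2) (real (p + q))"
      using n(2) by (simp add: add.commute)
    ultimately show ?thesis by blast
  qed
qed

section \<open>Spanning trees as minimal connecting edge sets\<close>

text \<open>Viewing spanning trees as minimal connecting sets removes cycles from the counting: to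
  combine networks, only connectivity has to be decomposed. The same notion counts the separating
  forests.\<close>

definition minimal_sets :: "'a set \<Rightarrow> ('a set \<Rightarrow> bool) \<Rightarrow> 'a set set" where
  "minimal_sets E P = {T. T \<subseteq> E \<and> P T \<and> (\<forall>S. S \<subset> T \<longrightarrow> \<not> P S)}"

lemma minimal_sets_cong:
  assumes "\<And>T. T \<subseteq> E \<Longrightarrow> P T \<longleftrightarrow> Q T"
  shows "minimal_sets E P = minimal_sets E Q"
proof -
  have "P S \<longleftrightarrow> Q S" if "S \<subset> T" "T \<subseteq> E" for S T using assms that by blast
  then have "(T \<subseteq> E \<and> P T \<and> (\<forall>S. S \<subset> T \<longrightarrow> \<not> P S)) \<longleftrightarrow> (T \<subseteq> E \<and> Q T \<and> (\<forall>S. S \<subset> T \<longrightarrow> \<not> Q S))" for T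
    using assms by (metis (no_types))
  then show ?thesis unfolding minimal_sets_def by simp
qed

section \<open>Trees, connectivity and contraction\<close>

text \<open>Supplies the path that an additional edge closes to a cycle. If the new first vertex
  already lies on the path, the path is cut back to it; otherwise the new edge is fresh because its
  end u is.\<close>

lemma simple_path_of_rtrancl:
  assumes "(u, v) \<in> (adjacency H)\<^sup>*"
  shows "\<exists>vs fs. hd vs = u \<and> last vs = v \<and> length vs = Suc (length fs) \<and> distinct vs \<and> distinct fs \<and>
    set fs \<subseteq> edges H \<and> (\<forall>i<length fs. ends H (fs ! i) = {vs ! i, vs ! Suc i})"
  using assms
proof (induction rule: converse_rtrancl_induct)
  case base
  show ?case by (intro exI[of _ "[v]"] exI[of _ "[]"]) auto
next
  case (step u w)
  then obtain f where f: "f \<in> edges H" "ends H f = {u, w}" unfolding adjacency_def by auto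
  from step.IH obtain vs fs where p: "hd vs = w" "last vs = v" "length vs = Suc (length fs)" "distinct vs"
    "distinct fs" "set fs \<subseteq> edges H" "\<And>i. i < length fs \<Longrightarrow> ends H (fs ! i) = {vs ! i, vs ! Suc i}" by blast
  have ne: "vs \<noteq> []" using p(3) by auto
  show ?case
  proof (cases "u \<in> set vs")
    case True
    then obtain i where i: "i < length vs" "vs ! i = u" by (auto simp: in_set_conv_nth)
    have "hd (drop i vs) = u" using i by (simp add: hd_drop_conv_nth)
    moreover have "set (drop i fs) \<subseteq> edges H" using p(6) set_drop_subset by fast
    ultimately show ?thesis using i p
      by (intro exI[of _ "drop i vs"] exI[of _ "drop i fs"]) auto
  next
    case False
    have "f \<notin> set fs"
    proof
      assume "f \<in> set fs"
      then obtain i where i: "i < length fs" "fs ! i = f" by (auto simp: in_set_conv_nth)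
      then have "u \<in> {vs ! i, vs ! Suc i}" using p(7)[of i] f by auto
      then show False using False i p(3) by auto
    qed
    moreover have "ends H ((f # fs) ! i) = {(u # vs) ! i, (u # vs) ! Suc i}" if "i < length (f # fs)" for i
      using that p f ne by (cases i) (auto simp: hd_conv_nth)
    ultimately show ?thesis using p f False ne
      by (intro exI[of _ "u # vs"] exI[of _ "f # fs"]) auto
  qed
qed

lemma rtrancl_map:
  assumes "(u, v) \<in> R\<^sup>*" "\<And>x y. (x, y) \<in> R \<Longrightarrow> (f x, f y) \<in> S\<^sup>*"
  shows "(f u, f v) \<in> S\<^sup>*"
  using assms(1) by (induction) (auto intro: rtrancl_trans assms(2))

lemma sym_adjacency: "sym (adjacency G)"
  unfolding adjacency_def sym_def by (auto simp: insert_commute)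

lemma adjacency_rtrancl_sym: "(u, v) \<in> (adjacency G)\<^sup>* \<Longrightarrow> (v, u) \<in> (adjacency G)\<^sup>*"
  using sym_rtrancl[OF sym_adjacency[of G]] by (auto dest: symD)

text \<open>If a connected S misses an edge f of T, a simple path in S between the ends of f closes
  with f to a cycle in T; for a loop f the path is trivial. Conversely, the last edge of a cycle can
  be bypassed along the rest of it, so deleting that edge keeps T connected.\<close>

lemma spanning_trees_eq_minimal_sets:
  assumes "\<And>f. f \<in> edges G \<Longrightarrow> ends G f \<subseteq> verts G \<and> card (ends G f) \<in> {1, 2}"
  shows "spanning_trees G = minimal_sets (edges G) (\<lambda>T. connected_mgraph (G\<lparr>edges := T\<rparr>))"
proof -
  have "is_tree (G\<lparr>edges := T\<rparr>) \<longleftrightarrow>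
      connected_mgraph (G\<lparr>edges := T\<rparr>) \<and> (\<forall>S. S \<subset> T \<longrightarrow> \<not> connected_mgraph (G\<lparr>edges := S\<rparr>))"
    if T: "T \<subseteq> edges G" for T
  proof -
    have "\<not> connected_mgraph (G\<lparr>edges := S\<rparr>)" if "acyclic_mgraph (G\<lparr>edges := T\<rparr>)" and S: "S \<subset> T" for S
    proof
      assume c: "connected_mgraph (G\<lparr>edges := S\<rparr>)"
      obtain f where f: "f \<in> T" "f \<notin> S" using S by blast
      obtain u v where uv: "ends G f = {u, v}" "u \<in> verts G" "v \<in> verts G"
      proof -
        have "ends G f \<subseteq> verts G" "card (ends G f) \<in> {1, 2}" using assms f T by auto
        then consider "card (ends G f) = 1" | "card (ends G f) = 2" by auto
        then show ?thesis using that \<open>ends G f \<subseteq> verts G\<close>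
          by cases (auto simp: card_1_singleton_iff card_2_iff)
      qed
      have "(u, v) \<in> (adjacency (G\<lparr>edges := S\<rparr>))\<^sup>*" using c uv unfolding connected_mgraph_def by simp
      then obtain vs fs where p: "hd vs = u" "last vs = v" "length vs = Suc (length fs)" "distinct vs"
        "distinct fs" "set fs \<subseteq> S" "\<And>i. i < length fs \<Longrightarrow> ends G (fs ! i) = {vs ! i, vs ! Suc i}"
        using simple_path_of_rtrancl[of u v "G\<lparr>edges := S\<rparr>"] by auto
      have hl: "vs ! 0 = u" "vs ! length fs = v"
        using p(1-3) by (auto simp: hd_conv_nth last_conv_nth simp flip: length_greater_0_conv)
      have "ends G ((fs @ [f]) ! i) = {vs ! i, vs ! (Suc i mod Suc (length fs))}" if "i < Suc (length fs)" for i
      proof (cases "i = length fs")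
        case True
        then show ?thesis using hl uv by (auto simp: nth_append)
      next
        case False
        then have "i < length fs" using that by simp
        then show ?thesis using p(7)[of i] by (auto simp: nth_append)
      qed
      moreover have "set (fs @ [f]) \<subseteq> T" "distinct (fs @ [f])" using p f S by auto
      ultimately have "is_cycle (G\<lparr>edges := T\<rparr>) vs (fs @ [f])" unfolding is_cycle_def using p by simp
      then show False using that unfolding acyclic_mgraph_def by blast
    qed
    moreover have "acyclic_mgraph (G\<lparr>edges := T\<rparr>)"
      if c: "connected_mgraph (G\<lparr>edges := T\<rparr>)" and m: "\<And>S. S \<subset> T \<Longrightarrow> \<not> connected_mgraph (G\<lparr>edges := S\<rparr>)"
    proof (rule ccontr)
      assume "\<not> acyclic_mgraph (G\<lparr>edges := T\<rparr>)"
      then obtain vs fs where "is_cycle (G\<lparr>edges := T\<rparr>) vs fs" unfolding acyclic_mgraph_def by blast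
      then have cyc: "fs \<noteq> []" "length vs = length fs" "distinct fs" "set fs \<subseteq> T"
        "\<And>i. i < length fs \<Longrightarrow> ends G (fs ! i) = {vs ! i, vs ! (Suc i mod length fs)}"
        unfolding is_cycle_def by auto
      define n where "n = length fs - 1"
      have n: "length fs = Suc n" using cyc(1) unfolding n_def by simp
      let ?f = "fs ! n" and ?H = "G\<lparr>edges := T - {fs ! n}\<rparr>"
      have f: "?f \<in> T" using cyc(4) n by auto
      have path: "(vs ! 0, vs ! i) \<in> (adjacency ?H)\<^sup>*" if "i \<le> n" for i
        using that
      proof (induction i)
        case (Suc i)
        have "fs ! i \<noteq> ?f" using Suc n cyc(3) by (auto simp: nth_eq_iff_index_eq)
        moreover have "fs ! i \<in> T" using cyc(4) Suc n by auto
        moreover have "ends G (fs ! i) = {vs ! i, vs ! Suc i}" using cyc(5)[of i] Suc n by simp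
        ultimately have "(vs ! i, vs ! Suc i) \<in> adjacency ?H" unfolding adjacency_def by auto
        then show ?case using Suc by (auto intro: rtrancl_into_rtrancl)
      qed simp
      have ends: "ends G ?f = {vs ! n, vs ! 0}" using cyc(5)[of n] n by simp
      have step: "(x, y) \<in> (adjacency ?H)\<^sup>*" if xy: "(x, y) \<in> adjacency (G\<lparr>edges := T\<rparr>)" for x y
      proof -
        obtain g where g: "g \<in> T" "ends G g = {x, y}" using xy unfolding adjacency_def by auto
        show ?thesis
        proof (cases "g = ?f")
          case True
          then have "{x, y} = {vs ! n, vs ! 0}" using g ends by simp
          then have "(x = vs ! n \<and> y = vs ! 0) \<or> (x = vs ! 0 \<and> y = vs ! n)" by (auto simp: doubleton_eq_iff)
          then show ?thesis using path[OF order_refl] adjacency_rtrancl_sym[OF path[OF order_refl]] by fast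
        next
          case False
          then have "(x, y) \<in> adjacency ?H" using g unfolding adjacency_def by auto
          then show ?thesis by blast
        qed
      qed
      have "(x, y) \<in> (adjacency ?H)\<^sup>*" if "(x, y) \<in> (adjacency (G\<lparr>edges := T\<rparr>))\<^sup>*" for x y
        using rtrancl_map[where f = "\<lambda>x. x", OF that step] .
      then have "connected_mgraph ?H" using c unfolding connected_mgraph_def by simp
      then show False using m[of "T - {?f}"] f by blast
    qed
    ultimately show ?thesis unfolding is_tree_def by blast
  qed
  then show ?thesis unfolding spanning_trees_def minimal_sets_def by auto
qed

text \<open>Vertices with the same class under \<open>merge_ends\<close> are equal or joined by e.
  Walks therefore project to the contraction, and lift back once e is available.\<close>

lemma connected_contract_iff:
  assumes e: "e \<in> edges G" "ends G e \<subseteq> verts G"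
    and T: "\<And>f. f \<in> T \<Longrightarrow> ends G f \<subseteq> verts G \<and> card (ends G f) \<in> {1, 2}"
    and e2: "card (ends G e) = 2"
  shows "connected_mgraph ((contract G e)\<lparr>edges := T\<rparr>) \<longleftrightarrow> connected_mgraph (G\<lparr>edges := insert e T\<rparr>)"
proof -
  let ?m = "merge_ends G e"
  let ?R = "adjacency (G\<lparr>edges := insert e T\<rparr>)" and ?C = "adjacency ((contract G e)\<lparr>edges := T\<rparr>)"
  obtain s t where st: "ends G e = {s, t}" using e2 by (auto simp: card_2_iff)
  have R: "(u, v) \<in> ?R\<^sup>*" if "?m u = ?m v" for u v
  proof (cases "u \<in> ends G e")
    case True
    then have "v \<in> ends G e" using that unfolding merge_ends_def by (auto split: if_splits)
    then have "u = v \<or> {u, v} = {s, t}" using True st by auto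
    then show ?thesis using st unfolding adjacency_def by auto
  next
    case False
    then have "u = v" using that unfolding merge_ends_def by (auto split: if_splits)
    then show ?thesis by simp
  qed
  have C: "(u, v) \<in> ?R\<^sup>*" if "(A, B) \<in> ?C\<^sup>*" "?m u = A" "?m v = B" for A B u v
    using that
  proof (induction arbitrary: v)
    case base
    then show ?case using R by metis
  next
    case (step A B)
    then obtain f where f: "f \<in> T" "?m ` ends G f = {A, B}" unfolding adjacency_def contract_def by auto
    obtain x y where xy: "ends G f = {x, y}"
    proof -
      have "card (ends G f) \<in> {1, 2}" using T f by auto
      then consider "card (ends G f) = 1" | "card (ends G f) = 2" by auto
      then show ?thesis using that by cases (auto simp: card_1_singleton_iff card_2_iff)
    qed
    then have "{?m x, ?m y} = {A, B}" using f by simp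
    then have "(?m x = A \<and> ?m y = B) \<or> (?m y = A \<and> ?m x = B)" by (auto simp: doubleton_eq_iff)
    then obtain x y where xy: "ends G f = {x, y}" "?m x = A" "?m y = B" using xy by (metis insert_commute)
    have "(u, x) \<in> ?R\<^sup>*" using step.IH xy step.prems by blast
    moreover have "(x, y) \<in> ?R" using f xy unfolding adjacency_def by auto
    moreover have "(y, v) \<in> ?R\<^sup>*" using R xy step.prems by metis
    ultimately show ?case by (meson rtrancl_into_rtrancl rtrancl_trans)
  qed
  have D: "(?m u, ?m v) \<in> ?C\<^sup>*" if "(u, v) \<in> ?R\<^sup>*" for u v
    using that
  proof (rule rtrancl_map)
    fix x y assume "(x, y) \<in> ?R"
    then obtain f where f: "f \<in> insert e T" "ends G f = {x, y}" unfolding adjacency_def by auto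
    show "(?m x, ?m y) \<in> ?C\<^sup>*"
    proof (cases "f = e")
      case True
      then have "?m x = ?m y" using f unfolding merge_ends_def by simp
      then show ?thesis by simp
    next
      case False
      then have "(?m x, ?m y) \<in> ?C" using f unfolding adjacency_def contract_def by auto
      then show ?thesis by blast
    qed
  qed
  have "(?m u, ?m v) \<in> ?C\<^sup>* \<longleftrightarrow> (u, v) \<in> ?R\<^sup>*" for u v using C D by blast
  then show ?thesis unfolding connected_mgraph_def by (simp add: contract_def)
qed

lemma tau_eq_card_minimal_sets:
  assumes "fin_mgraph G"
  shows "tau G = card (minimal_sets (edges G) (\<lambda>T. connected_mgraph (G\<lparr>edges := T\<rparr>)))"
  unfolding tau_def using assms by (subst spanning_trees_eq_minimal_sets) (auto simp: fin_mgraph_def)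

text \<open>In a simple graph no edge is parallel to e, so e is the only edge that contraction turns
  into a loop and removes.\<close>

lemma tau_contract_eq_card_minimal_sets:
  assumes G: "fin_mgraph G" "simple_mgraph G" and e: "e \<in> edges G"
  shows "tau (contract G e) =
    card (minimal_sets (edges G - {e}) (\<lambda>T. connected_mgraph (G\<lparr>edges := insert e T\<rparr>)))"
proof -
  have ends: "ends G f \<subseteq> verts G" "card (ends G f) = 2" if "f \<in> edges G" for f
    using G that unfolding fin_mgraph_def simple_mgraph_def loopless_def by auto
  have E: "edges (contract G e) = edges G - {e}"
  proof -
    have "card (merge_ends G e ` ends G f) \<noteq> 1 \<longleftrightarrow> f \<noteq> e" if f: "f \<in> edges G" for f
    proof
      assume "card (merge_ends G e ` ends G f) \<noteq> 1"
      moreover have "merge_ends G e ` ends G e = {ends G e}"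
        using ends(2)[OF e] unfolding merge_ends_def by (cases "ends G e = {}") auto
      ultimately show "f \<noteq> e" by auto
    next
      assume "f \<noteq> e"
      then have ne: "ends G f \<noteq> ends G e" using G(2) f e unfolding simple_mgraph_def inj_on_def by blast
      obtain x y where xy: "ends G f = {x, y}" "x \<noteq> y" using ends(2)[OF f] by (auto simp: card_2_iff)
      obtain s t where st: "ends G e = {s, t}" "s \<noteq> t" using ends(2)[OF e] by (auto simp: card_2_iff)
      have "merge_ends G e x \<noteq> merge_ends G e y"
        using ne xy st unfolding merge_ends_def by auto
      then show "card (merge_ends G e ` ends G f) \<noteq> 1" unfolding xy by simp
    qed
    then show ?thesis unfolding contract_def by auto
  qed
  have C: "ends (contract G e) f \<subseteq> verts (contract G e) \<and> card (ends (contract G e) f) \<in> {1, 2}"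
    if "f \<in> edges (contract G e)" for f
  proof -
    have f: "f \<in> edges G" using that unfolding contract_def by simp
    obtain x y where xy: "ends G f = {x, y}" using ends(2)[OF f] by (auto simp: card_2_iff)
    show ?thesis using ends(1)[OF f] xy unfolding contract_def by (auto simp: card_insert_if)
  qed
  have "minimal_sets (edges G - {e}) (\<lambda>T. connected_mgraph ((contract G e)\<lparr>edges := T\<rparr>)) =
    minimal_sets (edges G - {e}) (\<lambda>T. connected_mgraph (G\<lparr>edges := insert e T\<rparr>))"
    using ends e by (intro minimal_sets_cong connected_contract_iff) auto
  moreover have "spanning_trees (contract G e) =
    minimal_sets (edges (contract G e)) (\<lambda>T. connected_mgraph ((contract G e)\<lparr>edges := T\<rparr>))"
    by (rule spanning_trees_eq_minimal_sets) (rule C)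
  ultimately show ?thesis unfolding tau_def E by simp
qed

section \<open>Counting minimal sets of combined conditions\<close>

lemma minimal_sets_eqI: "T \<in> minimal_sets E P \<Longrightarrow> P S \<Longrightarrow> S \<subseteq> T \<Longrightarrow> S = T"
  unfolding minimal_sets_def by (auto simp: psubset_eq)

lemma minimal_setsI: "T \<subseteq> E \<Longrightarrow> P T \<Longrightarrow> (\<And>S. S \<subset> T \<Longrightarrow> \<not> P S) \<Longrightarrow> T \<in> minimal_sets E P"
  unfolding minimal_sets_def by simp

lemma minimal_sets_image:
  assumes "inj_on F E" "\<And>T. T \<subseteq> E \<Longrightarrow> P' (F ` T) \<longleftrightarrow> P T"
  shows "card (minimal_sets (F ` E) P') = card (minimal_sets E P)"
proof -
  have sub: "F ` S \<subset> F ` T \<longleftrightarrow> S \<subset> T" if "S \<subseteq> E" "T \<subseteq> E" for S T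
    using assms(1) that by (simp add: psubset_eq inj_on_image_subset_iff inj_on_image_eq_iff)
  have min: "F ` T \<in> minimal_sets (F ` E) P' \<longleftrightarrow> T \<in> minimal_sets E P" if T: "T \<subseteq> E" for T
  proof -
    have "(\<forall>S. S \<subset> F ` T \<longrightarrow> \<not> P' S) \<longleftrightarrow> (\<forall>S. S \<subset> T \<longrightarrow> \<not> P S)"
    proof (intro iffI allI impI)
      fix S assume a: "\<forall>S. S \<subset> F ` T \<longrightarrow> \<not> P' S" and S: "S \<subset> T"
      have "F ` S \<subset> F ` T" using sub[of S T] S T by blast
      then show "\<not> P S" using a assms(2)[of S] S T by blast
    next
      fix S assume a: "\<forall>S. S \<subset> T \<longrightarrow> \<not> P S" and S: "S \<subset> F ` T"
      then obtain R where R: "R \<subseteq> T" "S = F ` R" by (meson psubset_imp_subset subset_image_iff)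
      then have "R \<subset> T" using S by blast
      then show "\<not> P' S" using a assms(2)[of R] R T by blast
    qed
    then show ?thesis unfolding minimal_sets_def using T assms(2)[OF T] by (simp add: image_mono)
  qed
  have "minimal_sets (F ` E) P' = image F ` minimal_sets E P"
  proof
    show "minimal_sets (F ` E) P' \<subseteq> image F ` minimal_sets E P"
    proof
      fix U assume U: "U \<in> minimal_sets (F ` E) P'"
      then have "U \<subseteq> F ` E" unfolding minimal_sets_def by simp
      then obtain T where "T \<subseteq> E" "U = F ` T" by (meson subset_image_iff)
      then show "U \<in> image F ` minimal_sets E P" using U min by blast
    qed
    show "image F ` minimal_sets E P \<subseteq> minimal_sets (F ` E) P'"
    proof (rule image_subsetI)
      fix T assume T: "T \<in> minimal_sets E P"
      then have "T \<subseteq> E" unfolding minimal_sets_def by simp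
      then show "F ` T \<in> minimal_sets (F ` E) P'" using min T by simp
    qed
  qed
  moreover have "inj_on (image F) (minimal_sets E P)"
    using inj_on_image_Pow[OF assms(1)] by (rule inj_on_subset) (auto simp: minimal_sets_def)
  ultimately show ?thesis by (simp add: card_image)
qed

lemma subset_disjoint_Un_cases:
  assumes "U \<subseteq> E1 \<union> E2"
  obtains S T where "U = S \<union> T" "S \<subseteq> E1" "T \<subseteq> E2"
proof (rule that)
  show "U = (U \<inter> E1) \<union> (U \<inter> E2)" using assms by auto
qed auto

lemma inj_on_Un_disjoint:
  assumes "E1 \<inter> E2 = {}"
  shows "inj_on (\<lambda>(S, T). S \<union> T) (Pow E1 \<times> Pow E2)"
  using assms by (intro inj_on_inverseI[where g = "\<lambda>U. (U \<inter> E1, U \<inter> E2)"]) auto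

lemma card_minimal_sets_conj:
  assumes d: "E1 \<inter> E2 = {}" and P: "\<And>S T. S \<subseteq> E1 \<Longrightarrow> T \<subseteq> E2 \<Longrightarrow> P (S \<union> T) \<longleftrightarrow> P1 S \<and> P2 T"
  shows "card (minimal_sets (E1 \<union> E2) P) = card (minimal_sets E1 P1) * card (minimal_sets E2 P2)"
proof -
  have "minimal_sets (E1 \<union> E2) P = (\<lambda>(S, T). S \<union> T) ` (minimal_sets E1 P1 \<times> minimal_sets E2 P2)"
  proof (intro equalityI subsetI)
    fix U assume U: "U \<in> minimal_sets (E1 \<union> E2) P"
    then have "U \<subseteq> E1 \<union> E2" unfolding minimal_sets_def by simp
    then obtain S T where ST: "U = S \<union> T" "S \<subseteq> E1" "T \<subseteq> E2"
      by (rule subset_disjoint_Un_cases)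
    have m: "\<not> (P1 S' \<and> P2 T')" if "S' \<subseteq> S" "T' \<subseteq> T" "S' \<noteq> S \<or> T' \<noteq> T" for S' T'
    proof -
      have "S' \<union> T' \<subset> S \<union> T" using that d ST by blast
      then have "\<not> P (S' \<union> T')" using U ST unfolding minimal_sets_def by blast
      moreover have "S' \<subseteq> E1" "T' \<subseteq> E2" using that ST by auto
      ultimately show ?thesis using P by simp
    qed
    have "P (S \<union> T)" using U ST(1) unfolding minimal_sets_def by simp
    then have P12: "P1 S" "P2 T" using P[OF ST(2,3)] by auto
    have "\<not> P1 S'" if "S' \<subset> S" for S' using m[of S' T] P12 that by auto
    moreover have "\<not> P2 T'" if "T' \<subset> T" for T' using m[of S T'] P12 that by auto
    ultimately have "S \<in> minimal_sets E1 P1" "T \<in> minimal_sets E2 P2"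
      using ST(2,3) P12 by (simp_all add: minimal_setsI)
    then show "U \<in> (\<lambda>(S, T). S \<union> T) ` (minimal_sets E1 P1 \<times> minimal_sets E2 P2)" using ST by blast
  next
    fix U assume "U \<in> (\<lambda>(S, T). S \<union> T) ` (minimal_sets E1 P1 \<times> minimal_sets E2 P2)"
    then obtain S T where ST: "U = S \<union> T" "S \<in> minimal_sets E1 P1" "T \<in> minimal_sets E2 P2" by auto
    have sub: "S \<subseteq> E1" "T \<subseteq> E2" using ST(2-) unfolding minimal_sets_def by auto
    have "P1 S" "P2 T" using ST(2,3) unfolding minimal_sets_def by simp_all
    then have PU: "P U" using P[OF sub] ST(1) by simp
    have "\<not> P X" if X: "X \<subset> U" for X
    proof
      assume "P X"
      have "X \<subseteq> S \<union> T" using X ST by blast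
      then obtain S' T' where X': "X = S' \<union> T'" "S' \<subseteq> S" "T' \<subseteq> T"
        by (rule subset_disjoint_Un_cases)
      have "S' \<subseteq> E1" "T' \<subseteq> E2" using X' sub by auto
      then have "P1 S'" "P2 T'" using \<open>P X\<close> P X'(1) by simp_all
      then have "S' = S" "T' = T" using ST(2,3)[THEN minimal_sets_eqI] X' by simp_all
      then show False using X X'(1) ST(1) by simp
    qed
    then show "U \<in> minimal_sets (E1 \<union> E2) P" using sub PU ST(1) unfolding minimal_sets_def by auto
  qed
  moreover have "inj_on (\<lambda>(S, T). S \<union> T) (minimal_sets E1 P1 \<times> minimal_sets E2 P2)"
    by (rule inj_on_subset[OF inj_on_Un_disjoint[OF d]]) (auto simp: minimal_sets_def)
  ultimately show ?thesis by (simp add: card_image card_cartesian_product)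
qed

text \<open>\<open>A\<close> stands for connecting all vertices of a two-terminal network, \<open>B\<close> for connecting every
  vertex to one of the terminals; \<open>a\<close> and \<open>b\<close> count the minimal edge sets that do so.\<close>

definition two_level :: "'e set \<Rightarrow> ('e set \<Rightarrow> bool) \<Rightarrow> ('e set \<Rightarrow> bool) \<Rightarrow> nat \<Rightarrow> nat \<Rightarrow> bool" where
  "two_level E A B a b \<longleftrightarrow> finite E \<and> (\<forall>T\<subseteq>E. A T \<longrightarrow> (\<exists>f\<in>T. B (T - {f}))) \<and>
     card (minimal_sets E A) = a \<and> card (minimal_sets E B) = b"

text \<open>The danger is that a set minimal for one alternative properly contains one satisfying
  the other. The removal clause of \<open>two_level\<close> prevents it: if a subset of a B-minimal
  set satisfied A, removing some element would leave a smaller set satisfying B. So a smaller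
  solution has to use the same alternative, and the two families of pairs are disjoint.\<close>

lemma card_minimal_sets_disj:
  assumes d: "E1 \<inter> E2 = {}"
    and P: "\<And>S T. S \<subseteq> E1 \<Longrightarrow> T \<subseteq> E2 \<Longrightarrow> P (S \<union> T) \<longleftrightarrow> A1 S \<and> B2 T \<or> B1 S \<and> A2 T"
    and L1: "two_level E1 A1 B1 a1 b1" and L2: "two_level E2 A2 B2 a2 b2"
  shows "card (minimal_sets (E1 \<union> E2) P) = a1 * b2 + b1 * a2"
proof -
  let ?M = "minimal_sets E1 A1 \<times> minimal_sets E2 B2 \<union> minimal_sets E1 B1 \<times> minimal_sets E2 A2"
  have drop1: "\<exists>f\<in>S. B1 (S - {f})" if "S \<subseteq> E1" "A1 S" for S using L1 that unfolding two_level_def by blast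
  have drop2: "\<exists>f\<in>T. B2 (T - {f})" if "T \<subseteq> E2" "A2 T" for T using L2 that unfolding two_level_def by blast
  have n1: "\<not> A1 S'" if S: "S \<in> minimal_sets E1 B1" "S' \<subseteq> S" for S S'
  proof
    assume "A1 S'"
    then obtain f where f: "f \<in> S'" "B1 (S' - {f})" using drop1[of S'] S unfolding minimal_sets_def by blast
    have "S' - {f} \<subset> S" using f S by blast
    then show False using f S unfolding minimal_sets_def by blast
  qed
  have n2: "\<not> A2 T'" if T: "T \<in> minimal_sets E2 B2" "T' \<subseteq> T" for T T'
  proof
    assume "A2 T'"
    then obtain f where f: "f \<in> T'" "B2 (T' - {f})" using drop2[of T'] T unfolding minimal_sets_def by blast
    have "T' - {f} \<subset> T" using f T by blast
    then show False using f T unfolding minimal_sets_def by blast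
  qed
  have "minimal_sets (E1 \<union> E2) P = (\<lambda>(S, T). S \<union> T) ` ?M"
  proof (intro equalityI subsetI)
    fix U assume U: "U \<in> minimal_sets (E1 \<union> E2) P"
    then have "U \<subseteq> E1 \<union> E2" unfolding minimal_sets_def by simp
    then obtain S T where ST: "U = S \<union> T" "S \<subseteq> E1" "T \<subseteq> E2"
      by (rule subset_disjoint_Un_cases)
    have m: "\<not> (A1 S' \<and> B2 T')" "\<not> (B1 S' \<and> A2 T')" if "S' \<subseteq> S" "T' \<subseteq> T" "S' \<noteq> S \<or> T' \<noteq> T" for S' T'
    proof -
      have "S' \<union> T' \<subset> S \<union> T" using that d ST by blast
      then have "\<not> P (S' \<union> T')" using U ST unfolding minimal_sets_def by blast
      moreover have "S' \<subseteq> E1" "T' \<subseteq> E2" using that ST by auto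
      ultimately show "\<not> (A1 S' \<and> B2 T')" "\<not> (B1 S' \<and> A2 T')" using P by auto
    qed
    have "P (S \<union> T)" using U ST(1) unfolding minimal_sets_def by simp
    then consider "A1 S" "B2 T" | "B1 S" "A2 T" using P[OF ST(2,3)] by auto
    then have "(S, T) \<in> ?M"
    proof cases
      case 1
      then have "\<not> A1 S'" if "S' \<subset> S" for S' using m(1)[of S' T] that by auto
      moreover have "\<not> B2 T'" if "T' \<subset> T" for T' using m(1)[of S T'] 1 that by auto
      ultimately have "S \<in> minimal_sets E1 A1" "T \<in> minimal_sets E2 B2"
        using ST(2,3) 1 by (simp_all add: minimal_setsI)
      then show ?thesis by blast
    next
      case 2
      then have "\<not> B1 S'" if "S' \<subset> S" for S' using m(2)[of S' T] that by auto
      moreover have "\<not> A2 T'" if "T' \<subset> T" for T' using m(2)[of S T'] 2 that by auto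
      ultimately have "S \<in> minimal_sets E1 B1" "T \<in> minimal_sets E2 A2"
        using ST(2,3) 2 by (simp_all add: minimal_setsI)
      then show ?thesis by blast
    qed
    then show "U \<in> (\<lambda>(S, T). S \<union> T) ` ?M" using ST by blast
  next
    fix U assume "U \<in> (\<lambda>(S, T). S \<union> T) ` ?M"
    then obtain S T where ST: "U = S \<union> T" "(S, T) \<in> ?M" by auto
    have sub: "S \<subseteq> E1" "T \<subseteq> E2" using ST(2-) unfolding minimal_sets_def by auto
    have "A1 S \<and> B2 T \<or> B1 S \<and> A2 T" using ST(2) unfolding minimal_sets_def by force
    then have PU: "P U" using P[OF sub] ST(1) by simp
    have "\<not> P X" if X: "X \<subset> U" for X
    proof
      assume "P X"
      have "X \<subseteq> S \<union> T" using X ST by blast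
      then obtain S' T' where X': "X = S' \<union> T'" "S' \<subseteq> S" "T' \<subseteq> T"
        by (rule subset_disjoint_Un_cases)
      have "S' \<subseteq> E1" "T' \<subseteq> E2" using X' sub by auto
      then have or: "A1 S' \<and> B2 T' \<or> B1 S' \<and> A2 T'" using \<open>P X\<close> P X'(1) by simp
      have "S' = S \<and> T' = T"
      proof (cases "S \<in> minimal_sets E1 A1 \<and> T \<in> minimal_sets E2 B2")
        case True
        then have "A1 S' \<and> B2 T'" using or n2[of T T'] X' by simp
        then show ?thesis using True X' minimal_sets_eqI[of S E1 A1 S'] minimal_sets_eqI[of T E2 B2 T'] by simp
      next
        case False
        then have M: "S \<in> minimal_sets E1 B1" "T \<in> minimal_sets E2 A2" using ST(2) by auto
        then have "B1 S' \<and> A2 T'" using or n1[of S S'] X' by simp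
        then show ?thesis using M X' minimal_sets_eqI[of S E1 B1 S'] minimal_sets_eqI[of T E2 A2 T'] by simp
      qed
      then show False using X X'(1) ST(1) by simp
    qed
    then show "U \<in> minimal_sets (E1 \<union> E2) P" using sub PU ST(1) unfolding minimal_sets_def by auto
  qed
  moreover have "inj_on (\<lambda>(S, T). S \<union> T) ?M"
    by (rule inj_on_subset[OF inj_on_Un_disjoint[OF d]]) (auto simp: minimal_sets_def)
  moreover have "card ?M = a1 * b2 + b1 * a2"
  proof -
    have "finite (minimal_sets E1 Q)" "finite (minimal_sets E2 R)" for Q R
      using L1 L2 unfolding two_level_def minimal_sets_def by (auto intro: finite_subset[of _ "Pow E1"] finite_subset[of _ "Pow E2"])
    moreover have "S \<notin> minimal_sets E1 B1" if "S \<in> minimal_sets E1 A1" for S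
    proof
      assume "S \<in> minimal_sets E1 B1"
      then have "\<not> A1 S" by (rule n1) simp
      then show False using that by (simp add: minimal_sets_def)
    qed
    then have "minimal_sets E1 A1 \<inter> minimal_sets E1 B1 = {}" by (simp add: disjoint_iff)
    ultimately have "card ?M = card (minimal_sets E1 A1) * card (minimal_sets E2 B2)
        + card (minimal_sets E1 B1) * card (minimal_sets E2 A2)"
      by (subst card_Un_disjoint) (auto simp: card_cartesian_product)
    then show ?thesis using L1 L2 unfolding two_level_def by simp
  qed
  ultimately show ?thesis by (simp add: card_image)
qed

text \<open>The ratios b / a add: \<open>(a1 * b2 + b1 * a2) / (a1 * a2)\<close> is
  \<open>b1 / a1 + b2 / a2\<close>, the series law.\<close>

lemma two_level_series:
  assumes d: "E1 \<inter> E2 = {}"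
    and A: "\<And>S T. S \<subseteq> E1 \<Longrightarrow> T \<subseteq> E2 \<Longrightarrow> A (S \<union> T) \<longleftrightarrow> A1 S \<and> A2 T"
    and B: "\<And>S T. S \<subseteq> E1 \<Longrightarrow> T \<subseteq> E2 \<Longrightarrow> B (S \<union> T) \<longleftrightarrow> A1 S \<and> B2 T \<or> B1 S \<and> A2 T"
    and L1: "two_level E1 A1 B1 a1 b1" and L2: "two_level E2 A2 B2 a2 b2"
  shows "two_level (E1 \<union> E2) A B (a1 * a2) (a1 * b2 + b1 * a2)"
proof -
  have "\<exists>f\<in>U. B (U - {f})" if U: "U \<subseteq> E1 \<union> E2" "A U" for U
  proof -
    obtain S T where ST: "U = S \<union> T" "S \<subseteq> E1" "T \<subseteq> E2" using U(1) by (rule subset_disjoint_Un_cases)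
    then have a: "A1 S" "A2 T" using A U by auto
    then obtain f where f: "f \<in> S" "B1 (S - {f})" using L1 ST unfolding two_level_def by blast
    have "U - {f} = (S - {f}) \<union> T" using ST f d by blast
    then have "B (U - {f})" using B[of "S - {f}" T] ST f a by auto
    then show ?thesis using f ST by blast
  qed
  then show ?thesis
    using card_minimal_sets_conj[where P = A and ?P1.0 = A1 and ?P2.0 = A2, OF d A]
      card_minimal_sets_disj[where P = B, OF d B L1 L2] L1 L2
    unfolding two_level_def by auto
qed

text \<open>Dual to the series case: here the conductances a / b add.\<close>

lemma two_level_parallel:
  assumes d: "E1 \<inter> E2 = {}"
    and A: "\<And>S T. S \<subseteq> E1 \<Longrightarrow> T \<subseteq> E2 \<Longrightarrow> A (S \<union> T) \<longleftrightarrow> A1 S \<and> B2 T \<or> B1 S \<and> A2 T"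
    and B: "\<And>S T. S \<subseteq> E1 \<Longrightarrow> T \<subseteq> E2 \<Longrightarrow> B (S \<union> T) \<longleftrightarrow> B1 S \<and> B2 T"
    and L1: "two_level E1 A1 B1 a1 b1" and L2: "two_level E2 A2 B2 a2 b2"
  shows "two_level (E1 \<union> E2) A B (a1 * b2 + b1 * a2) (b1 * b2)"
proof -
  have "\<exists>f\<in>U. B (U - {f})" if U: "U \<subseteq> E1 \<union> E2" "A U" for U
  proof -
    obtain S T where ST: "U = S \<union> T" "S \<subseteq> E1" "T \<subseteq> E2" using U(1) by (rule subset_disjoint_Un_cases)
    then consider "A1 S" "B2 T" | "B1 S" "A2 T" using A U by auto
    then show ?thesis
    proof cases
      case 1
      then obtain f where f: "f \<in> S" "B1 (S - {f})" using L1 ST unfolding two_level_def by blast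
      have "U - {f} = (S - {f}) \<union> T" using ST f d by blast
      then have "B (U - {f})" using B[of "S - {f}" T] ST f 1 by auto
      then show ?thesis using f ST by blast
    next
      case 2
      then obtain f where f: "f \<in> T" "B2 (T - {f})" using L2 ST unfolding two_level_def by blast
      have "U - {f} = S \<union> (T - {f})" using ST f d by blast
      then have "B (U - {f})" using B[of S "T - {f}"] ST f 2 by auto
      then show ?thesis using f ST by blast
    qed
  qed
  then show ?thesis
    using card_minimal_sets_conj[where P = B and ?P1.0 = B1 and ?P2.0 = B2, OF d B]
      card_minimal_sets_disj[where P = A, OF d A L1 L2] L1 L2
    unfolding two_level_def by auto
qed

section \<open>Series and parallel composition of plane networks\<close>

text \<open>A walk can change sides only at s or t. As long as t has not been reached, whatever is
  reachable from s is reachable within one side.\<close>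

lemma rtrancl_Un_parallel_terminals:
  assumes R: "R1 \<subseteq> V1 \<times> V1" "R2 \<subseteq> V2 \<times> V2" and V: "V1 \<inter> V2 \<subseteq> {s, t}"
  shows "(s, t) \<in> (R1 \<union> R2)\<^sup>* \<longleftrightarrow> (s, t) \<in> R1\<^sup>* \<or> (s, t) \<in> R2\<^sup>*"
proof
  assume a: "(s, t) \<in> (R1 \<union> R2)\<^sup>*"
  show "(s, t) \<in> R1\<^sup>* \<or> (s, t) \<in> R2\<^sup>*"
  proof (rule ccontr)
    assume n: "\<not> ?thesis"
    have in1: "x = s \<or> x \<in> V1" if "(s, x) \<in> R1\<^sup>*" for x using that R by (cases rule: rtranclE) auto
    have in2: "x = s \<or> x \<in> V2" if "(s, x) \<in> R2\<^sup>*" for x using that R by (cases rule: rtranclE) auto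
    have "(s, x) \<in> R1\<^sup>* \<or> (s, x) \<in> R2\<^sup>*" if "(s, x) \<in> (R1 \<union> R2)\<^sup>*" for x
      using that
    proof induction
      case (step x y)
      show ?case
      proof (cases "x = s")
        case True
        then show ?thesis using step.hyps(2) by auto
      next
        case False
        have "x \<noteq> t" using step.IH n by auto
        then have "x \<notin> V1 \<inter> V2" using False V by auto
        then show ?thesis using step False in1[of x] in2[of x] R
          by (auto intro: rtrancl_into_rtrancl)
      qed
    qed simp
    then show False using a n by blast
  qed
next
  assume "(s, t) \<in> R1\<^sup>* \<or> (s, t) \<in> R2\<^sup>*"
  then show "(s, t) \<in> (R1 \<union> R2)\<^sup>*" using rtrancl_mono[of R1 "R1 \<union> R2"] rtrancl_mono[of R2 "R1 \<union> R2"] by blast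
qed

text \<open>A connection between s and t is not excluded here. In a minimal edge set it cannot
  occur, since some edge of it could be dropped; the minimal sets are thus the forests that separate
  the terminals.\<close>

definition spans :: "'v set \<Rightarrow> 'v rel \<Rightarrow> 'v \<Rightarrow> 'v \<Rightarrow> bool" where
  "spans V R s t \<longleftrightarrow> (\<forall>v\<in>V. (v, s) \<in> R\<^sup>* \<or> (v, t) \<in> R\<^sup>*)"

text \<open>Up to its first visit to a terminal, a walk that starts in V1 stays in R1.\<close>

lemma spans_parallel_half:
  assumes R: "R1 \<subseteq> V1 \<times> V1" "R2 \<subseteq> V2 \<times> V2" and V: "V1 \<inter> V2 \<subseteq> {s, t}" and sp: "spans V1 (R1 \<union> R2) s t"
  shows "spans V1 R1 s t"
proof -
  have "v \<in> V1 \<longrightarrow> (v, s) \<in> R1\<^sup>* \<or> (v, t) \<in> R1\<^sup>*" if "(v, x) \<in> (R1 \<union> R2)\<^sup>*" "x \<in> {s, t}" for v x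
    using that
  proof (induction rule: converse_rtrancl_induct)
    case base
    then show ?case by auto
  next
    case (step v w)
    then show ?case using R V by (blast intro: converse_rtrancl_into_rtrancl)
  qed
  then show ?thesis using sp unfolding spans_def by blast
qed

lemma spans_parallel:
  assumes R: "R1 \<subseteq> V1 \<times> V1" "R2 \<subseteq> V2 \<times> V2" and V: "V1 \<inter> V2 \<subseteq> {s, t}"
  shows "spans (V1 \<union> V2) (R1 \<union> R2) s t \<longleftrightarrow> spans V1 R1 s t \<and> spans V2 R2 s t"
proof
  assume a: "spans (V1 \<union> V2) (R1 \<union> R2) s t"
  then have "spans V1 (R1 \<union> R2) s t" "spans V2 (R2 \<union> R1) s t" unfolding spans_def by (auto simp: Un_commute)
  then show "spans V1 R1 s t \<and> spans V2 R2 s t" using spans_parallel_half R V by (metis Int_commute)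
next
  assume "spans V1 R1 s t \<and> spans V2 R2 s t"
  then show "spans (V1 \<union> V2) (R1 \<union> R2) s t"
    using rtrancl_mono[of R1 "R1 \<union> R2"] rtrancl_mono[of R2 "R1 \<union> R2"] unfolding spans_def by blast
qed

text \<open>Collapsing the far side to the cut vertex m turns every walk into a walk in R1, because
  each step of R2 becomes stationary.\<close>

lemma rtrancl_Un_retract:
  assumes R: "R1 \<subseteq> V1 \<times> V1" "R2 \<subseteq> V2 \<times> V2" and V: "V1 \<inter> V2 \<subseteq> {m}" and uv: "(u, v) \<in> (R1 \<union> R2)\<^sup>*"
  shows "(if u \<in> V1 then u else m, if v \<in> V1 then v else m) \<in> R1\<^sup>*"
proof (rule rtrancl_map[where f = "\<lambda>x. if x \<in> V1 then x else m", OF uv])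
  fix x y assume "(x, y) \<in> R1 \<union> R2"
  then consider "(x, y) \<in> R1" | "(x, y) \<in> R2" by blast
  then show "(if x \<in> V1 then x else m, if y \<in> V1 then y else m) \<in> R1\<^sup>*"
  proof cases
    case 1
    then show ?thesis using R(1) by auto
  next
    case 2
    then have "x \<in> V2" "y \<in> V2" using R(2) by auto
    then have "(if x \<in> V1 then x else m) = m" "(if y \<in> V1 then y else m) = m" using V by auto
    then show ?thesis by simp
  qed
qed

lemma rtrancl_Un_series:
  assumes R: "R1 \<subseteq> V1 \<times> V1" "R2 \<subseteq> V2 \<times> V2" and V: "V1 \<inter> V2 = {m}" "s \<in> V1" "t \<in> V2"
  shows "(s, t) \<in> (R1 \<union> R2)\<^sup>* \<longleftrightarrow> (s, m) \<in> R1\<^sup>* \<and> (m, t) \<in> R2\<^sup>*"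
proof
  assume a: "(s, t) \<in> (R1 \<union> R2)\<^sup>*"
  then have b: "(s, t) \<in> (R2 \<union> R1)\<^sup>*" by (simp add: Un_commute)
  have "(if t \<in> V1 then t else m) = m" "(if s \<in> V2 then s else m) = m" using V by auto
  then show "(s, m) \<in> R1\<^sup>* \<and> (m, t) \<in> R2\<^sup>*"
    using rtrancl_Un_retract[OF R _ a, of m] rtrancl_Un_retract[OF R(2,1) _ b, of m] V by (auto simp: Int_commute)
next
  assume "(s, m) \<in> R1\<^sup>* \<and> (m, t) \<in> R2\<^sup>*"
  then show "(s, t) \<in> (R1 \<union> R2)\<^sup>*"
    using rtrancl_mono[of R1 "R1 \<union> R2"] rtrancl_mono[of R2 "R1 \<union> R2"] by (blast intro: rtrancl_trans)
qed

text \<open>The last conjunct says that the middle vertex m must itself reach an outer terminal, so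
  at most one side may be separated.\<close>

lemma spans_series:
  assumes R: "R1 \<subseteq> V1 \<times> V1" "R2 \<subseteq> V2 \<times> V2" and V: "V1 \<inter> V2 = {m}" "s \<in> V1" "t \<in> V2"
    and sym: "sym R1" "sym R2"
  shows "spans (V1 \<union> V2) (R1 \<union> R2) s t \<longleftrightarrow>
    spans V1 R1 s m \<and> spans V2 R2 m t \<and> ((s, m) \<in> R1\<^sup>* \<or> (m, t) \<in> R2\<^sup>*)"
proof -
  have sy: "(x, y) \<in> R1\<^sup>* \<longleftrightarrow> (y, x) \<in> R1\<^sup>*" "(x, y) \<in> R2\<^sup>* \<longleftrightarrow> (y, x) \<in> R2\<^sup>*" for x y
    using sym by (meson sym_rtrancl symD)+
  have m: "m \<in> V1" "m \<in> V2" using V by auto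
  have r1: "(if u \<in> V1 then u else m, if v \<in> V1 then v else m) \<in> R1\<^sup>*" if "(u, v) \<in> (R1 \<union> R2)\<^sup>*" for u v
    using rtrancl_Un_retract[OF R _ that] V by simp
  have r2: "(if u \<in> V2 then u else m, if v \<in> V2 then v else m) \<in> R2\<^sup>*" if "(u, v) \<in> (R1 \<union> R2)\<^sup>*" for u v
    using rtrancl_Un_retract[OF R(2,1)] that V by (simp add: Un_commute Int_commute)
  have tm: "(if t \<in> V1 then t else m) = m" and sm: "(if s \<in> V2 then s else m) = m" using V by auto
  show ?thesis
  proof
    assume a: "spans (V1 \<union> V2) (R1 \<union> R2) s t"
    have "(v, s) \<in> R1\<^sup>* \<or> (v, m) \<in> R1\<^sup>*" if "v \<in> V1" for v
      using a that r1[of v s] r1[of v t] V tm unfolding spans_def by auto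
    moreover have "(v, m) \<in> R2\<^sup>* \<or> (v, t) \<in> R2\<^sup>*" if "v \<in> V2" for v
      using a that r2[of v s] r2[of v t] V sm unfolding spans_def by auto
    moreover have "(m, s) \<in> R1\<^sup>* \<or> (m, t) \<in> R2\<^sup>*"
      using a m r1[of m s] r2[of m t] V unfolding spans_def by auto
    ultimately show "spans V1 R1 s m \<and> spans V2 R2 m t \<and> ((s, m) \<in> R1\<^sup>* \<or> (m, t) \<in> R2\<^sup>*)"
      using sy unfolding spans_def by blast
  next
    assume a: "spans V1 R1 s m \<and> spans V2 R2 m t \<and> ((s, m) \<in> R1\<^sup>* \<or> (m, t) \<in> R2\<^sup>*)"
    have i: "R1\<^sup>* \<subseteq> (R1 \<union> R2)\<^sup>*" "R2\<^sup>* \<subseteq> (R1 \<union> R2)\<^sup>*" by (intro rtrancl_mono; blast)+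
    have "(m, s) \<in> (R1 \<union> R2)\<^sup>* \<or> (m, t) \<in> (R1 \<union> R2)\<^sup>*" using a sy i by blast
    then have mm: "(v, s) \<in> (R1 \<union> R2)\<^sup>* \<or> (v, t) \<in> (R1 \<union> R2)\<^sup>*" if "(v, m) \<in> (R1 \<union> R2)\<^sup>*" for v
      using that by (blast intro: rtrancl_trans)
    show "spans (V1 \<union> V2) (R1 \<union> R2) s t" unfolding spans_def
    proof
      fix v assume "v \<in> V1 \<union> V2"
      then have "(v, s) \<in> R1\<^sup>* \<or> (v, m) \<in> R1\<^sup>* \<or> (v, m) \<in> R2\<^sup>* \<or> (v, t) \<in> R2\<^sup>*" using a unfolding spans_def by blast
      then show "(v, s) \<in> (R1 \<union> R2)\<^sup>* \<or> (v, t) \<in> (R1 \<union> R2)\<^sup>*" using i mm by blast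
    qed
  qed
qed

section \<open>Networks whose edges are arcs\<close>

definition arc_ends :: "(real \<Rightarrow> 'a::topological_space) \<Rightarrow> 'a set" where
  "arc_ends g = {pathstart g, pathfinish g}"

definition arc_link :: "(real \<Rightarrow> 'a::topological_space) set \<Rightarrow> 'a rel" where
  "arc_link E = {(u, v). \<exists>g\<in>E. arc_ends g = {u, v}}"

definition arc_region :: "'a set \<Rightarrow> (real \<Rightarrow> 'a::topological_space) set \<Rightarrow> 'a set" where
  "arc_region V E = V \<union> \<Union> (path_image ` E)"

text \<open>The arcs themselves are the edges, so a drawing is part of the network and a map of the
  plane acts on both at once. Distinct values of \<open>arc_ends\<close> rule out parallel edges,
  and \<open>arc\<close> rules out loops.\<close>

definition plane_arcs :: "'a::topological_space set \<Rightarrow> (real \<Rightarrow> 'a) set \<Rightarrow> bool" where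
  "plane_arcs V E \<longleftrightarrow> finite V \<and> finite E \<and> (\<forall>g\<in>E. arc g \<and> path_image g \<inter> V = arc_ends g) \<and>
     (\<forall>g\<in>E. \<forall>h\<in>E. g \<noteq> h \<longrightarrow>
        path_image g \<inter> path_image h \<subseteq> arc_ends g \<inter> arc_ends h \<and> arc_ends g \<noteq> arc_ends h)"

definition arc_network ::
  "'a::topological_space set \<Rightarrow> (real \<Rightarrow> 'a) set \<Rightarrow> 'a \<Rightarrow> 'a \<Rightarrow> nat \<Rightarrow> nat \<Rightarrow> bool" where
  "arc_network V E s t a b \<longleftrightarrow> plane_arcs V E \<and> s \<in> V \<and> t \<in> V \<and> s \<noteq> t \<and>
     two_level E (\<lambda>T. spans V (arc_link T) s t \<and> (s, t) \<in> (arc_link T)\<^sup>*) (\<lambda>T. spans V (arc_link T) s t) a b \<and>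
     spans V (arc_link E) s t \<and> (s, t) \<in> (arc_link E)\<^sup>*"

lemma arc_link_Un: "arc_link (S \<union> T) = arc_link S \<union> arc_link T"
  unfolding arc_link_def by auto

lemma sym_arc_link: "sym (arc_link T)"
  unfolding arc_link_def sym_def by (auto simp: insert_commute)

lemma arc_link_subset:
  assumes "plane_arcs V E" "T \<subseteq> E"
  shows "arc_link T \<subseteq> V \<times> V"
proof -
  have "arc_ends g \<subseteq> V" if "g \<in> T" for g using that assms unfolding plane_arcs_def by blast
  then show ?thesis unfolding arc_link_def by auto
qed

lemma plane_arcs_ends:
  assumes "plane_arcs V E" "g \<in> E"
  shows "arc_ends g \<subseteq> V" "pathstart g \<noteq> pathfinish g"
proof -
  have g: "arc g" "path_image g \<inter> V = arc_ends g" using assms unfolding plane_arcs_def by simp_all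
  then show "arc_ends g \<subseteq> V" by blast
  show "pathstart g \<noteq> pathfinish g" using arc_distinct_ends[OF g(1)] by simp
qed

lemma plane_arcs_Un:
  assumes 1: "plane_arcs V1 E1" and 2: "plane_arcs V2 E2"
    and R: "arc_region V1 E1 \<inter> arc_region V2 E2 \<subseteq> V1 \<inter> V2"
    and ne: "\<And>g h. g \<in> E1 \<Longrightarrow> h \<in> E2 \<Longrightarrow> arc_ends g \<noteq> arc_ends h"
  shows "plane_arcs (V1 \<union> V2) (E1 \<union> E2)"
proof -
  have i1: "path_image g \<inter> V1 = arc_ends g" if "g \<in> E1" for g using 1 that unfolding plane_arcs_def by simp
  have i2: "path_image g \<inter> V2 = arc_ends g" if "g \<in> E2" for g using 2 that unfolding plane_arcs_def by simp
  have sub1: "V1 \<subseteq> arc_region V1 E1" "\<And>g. g \<in> E1 \<Longrightarrow> path_image g \<subseteq> arc_region V1 E1"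
    unfolding arc_region_def by auto
  have sub2: "V2 \<subseteq> arc_region V2 E2" "\<And>g. g \<in> E2 \<Longrightarrow> path_image g \<subseteq> arc_region V2 E2"
    unfolding arc_region_def by auto
  have "path_image g \<inter> (V1 \<union> V2) = arc_ends g" if "g \<in> E1" for g
    using i1[OF that] sub1(2)[OF that] sub2(1) R by blast
  moreover have "path_image g \<inter> (V1 \<union> V2) = arc_ends g" if "g \<in> E2" for g
    using i2[OF that] sub2(2)[OF that] sub1(1) R by blast
  moreover have "path_image g \<inter> path_image h \<subseteq> arc_ends g \<inter> arc_ends h" if "g \<in> E1" "h \<in> E2" for g h
    using i1[OF that(1)] i2[OF that(2)] sub1(2)[OF that(1)] sub2(2)[OF that(2)] R by blast
  ultimately show ?thesis using 1 2 ne ne[symmetric] unfolding plane_arcs_def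
    by (simp add: ball_Un) (metis Int_commute)
qed

text \<open>The last conclusion is what \<open>arc_network_parallel\<close> asks of one side: with
  no arc running from terminal to terminal, a parallel composition creates no parallel
  edges.\<close>

lemma arc_network_series:
  assumes N1: "arc_network V1 E1 s m a1 b1" and N2: "arc_network V2 E2 m t a2 b2"
    and R: "arc_region V1 E1 \<inter> arc_region V2 E2 \<subseteq> {m}"
  shows "arc_network (V1 \<union> V2) (E1 \<union> E2) s t (a1 * a2) (a1 * b2 + b1 * a2)"
    and "V1 \<inter> V2 = {m}"
    and "\<And>g. g \<in> E1 \<union> E2 \<Longrightarrow> arc_ends g \<noteq> {s, t}"
proof -
  have P: "plane_arcs V1 E1" "plane_arcs V2 E2" using N1 N2 unfolding arc_network_def by auto
  have st: "s \<in> V1" "m \<in> V1" "s \<noteq> m" "m \<in> V2" "t \<in> V2" "m \<noteq> t" using N1 N2 unfolding arc_network_def by auto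
  show V: "V1 \<inter> V2 = {m}" using R st unfolding arc_region_def by auto
  have e1: "arc_ends g \<subseteq> V1" "pathstart g \<noteq> pathfinish g" if "g \<in> E1" for g
    using plane_arcs_ends[OF P(1) that] .
  have e2: "arc_ends g \<subseteq> V2" "pathstart g \<noteq> pathfinish g" if "g \<in> E2" for g
    using plane_arcs_ends[OF P(2) that] .
  have ne: "arc_ends g \<noteq> arc_ends h" if "g \<in> E1" "h \<in> E2" for g h
  proof
    assume "arc_ends g = arc_ends h"
    then have "arc_ends g \<subseteq> {m}" using e1(1)[OF that(1)] e2(1)[OF that(2)] V by auto
    then show False using e1(2)[OF that(1)] unfolding arc_ends_def by auto
  qed
  have int: "x = m" if "x \<in> V1" "x \<in> V2" for x using that V by (metis IntI singletonD)
  have st': "s \<noteq> t" "t \<notin> V1" "s \<notin> V2" using st int[of s] int[of t] by metis+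
  show "arc_ends g \<noteq> {s, t}" if "g \<in> E1 \<union> E2" for g
    using that
  proof
    assume "g \<in> E1"
    then show ?thesis using e1(1)[of g] st' by auto
  next
    assume "g \<in> E2"
    then show ?thesis using e2(1)[of g] st' by auto
  qed
  have d: "E1 \<inter> E2 = {}" using ne by auto
  have J: "(s, t) \<in> (arc_link (S \<union> T))\<^sup>* \<longleftrightarrow> (s, m) \<in> (arc_link S)\<^sup>* \<and> (m, t) \<in> (arc_link T)\<^sup>*"
    if "S \<subseteq> E1" "T \<subseteq> E2" for S T
    unfolding arc_link_Un using arc_link_subset[OF P(1) that(1)] arc_link_subset[OF P(2) that(2)] V st
    by (intro rtrancl_Un_series) simp_all
  have Sp: "spans (V1 \<union> V2) (arc_link (S \<union> T)) s t \<longleftrightarrow> spans V1 (arc_link S) s m \<and> spans V2 (arc_link T) m t \<and>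
     ((s, m) \<in> (arc_link S)\<^sup>* \<or> (m, t) \<in> (arc_link T)\<^sup>*)"
    if "S \<subseteq> E1" "T \<subseteq> E2" for S T
    unfolding arc_link_Un using arc_link_subset[OF P(1) that(1)] arc_link_subset[OF P(2) that(2)] V st
    by (intro spans_series sym_arc_link) simp_all
  have "plane_arcs (V1 \<union> V2) (E1 \<union> E2)" using P R V ne by (intro plane_arcs_Un) auto
  moreover have "two_level (E1 \<union> E2)
     (\<lambda>T. spans (V1 \<union> V2) (arc_link T) s t \<and> (s, t) \<in> (arc_link T)\<^sup>*) (\<lambda>T. spans (V1 \<union> V2) (arc_link T) s t)
     (a1 * a2) (a1 * b2 + b1 * a2)"
    by (rule two_level_series[where ?A1.0 = "\<lambda>T. spans V1 (arc_link T) s m \<and> (s, m) \<in> (arc_link T)\<^sup>*"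
          and ?B1.0 = "\<lambda>T. spans V1 (arc_link T) s m"
          and ?A2.0 = "\<lambda>T. spans V2 (arc_link T) m t \<and> (m, t) \<in> (arc_link T)\<^sup>*"
          and ?B2.0 = "\<lambda>T. spans V2 (arc_link T) m t", OF d])
      (use J Sp N1 N2 in \<open>auto simp: arc_network_def\<close>)
  ultimately show "arc_network (V1 \<union> V2) (E1 \<union> E2) s t (a1 * a2) (a1 * b2 + b1 * a2)"
    using N1 N2 st st' J[OF order_refl order_refl] Sp[OF order_refl order_refl] unfolding arc_network_def by simp
qed

lemma arc_network_parallel:
  assumes N1: "arc_network V1 E1 s t a1 b1" and N2: "arc_network V2 E2 s t a2 b2"
    and R: "arc_region V1 E1 \<inter> arc_region V2 E2 \<subseteq> {s, t}"
    and E1: "\<And>g. g \<in> E1 \<Longrightarrow> arc_ends g \<noteq> {s, t}"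
  shows "arc_network (V1 \<union> V2) (E1 \<union> E2) s t (a1 * b2 + b1 * a2) (b1 * b2)"
    and "V1 \<inter> V2 = {s, t}"
proof -
  have P: "plane_arcs V1 E1" "plane_arcs V2 E2" using N1 N2 unfolding arc_network_def by auto
  have st: "s \<in> V1" "t \<in> V1" "s \<in> V2" "t \<in> V2" "s \<noteq> t" using N1 N2 unfolding arc_network_def by auto
  show V: "V1 \<inter> V2 = {s, t}" using R st unfolding arc_region_def by auto
  have e1: "arc_ends g \<subseteq> V1" "pathstart g \<noteq> pathfinish g" if "g \<in> E1" for g
    using plane_arcs_ends[OF P(1) that] .
  have e2: "arc_ends g \<subseteq> V2" if "g \<in> E2" for g
    using plane_arcs_ends[OF P(2) that] by simp
  have ne: "arc_ends g \<noteq> arc_ends h" if "g \<in> E1" "h \<in> E2" for g h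
  proof
    assume "arc_ends g = arc_ends h"
    then have "arc_ends g \<subseteq> {s, t}" using e1(1)[OF that(1)] e2[OF that(2)] V by auto
    then show False using e1(2)[OF that(1)] E1[OF that(1)] unfolding arc_ends_def by auto
  qed
  have d: "E1 \<inter> E2 = {}" using ne by auto
  have J: "(s, t) \<in> (arc_link (S \<union> T))\<^sup>* \<longleftrightarrow> (s, t) \<in> (arc_link S)\<^sup>* \<or> (s, t) \<in> (arc_link T)\<^sup>*"
    if "S \<subseteq> E1" "T \<subseteq> E2" for S T
    unfolding arc_link_Un using arc_link_subset[OF P(1) that(1)] arc_link_subset[OF P(2) that(2)] V st
    by (intro rtrancl_Un_parallel_terminals[of _ V1 _ V2]) simp_all
  have Sp: "spans (V1 \<union> V2) (arc_link (S \<union> T)) s t \<longleftrightarrow> spans V1 (arc_link S) s t \<and> spans V2 (arc_link T) s t"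
    if "S \<subseteq> E1" "T \<subseteq> E2" for S T
    unfolding arc_link_Un using arc_link_subset[OF P(1) that(1)] arc_link_subset[OF P(2) that(2)] V st
    by (intro spans_parallel) simp_all
  have "plane_arcs (V1 \<union> V2) (E1 \<union> E2)" using P R V ne by (intro plane_arcs_Un) auto
  moreover have "two_level (E1 \<union> E2)
     (\<lambda>T. spans (V1 \<union> V2) (arc_link T) s t \<and> (s, t) \<in> (arc_link T)\<^sup>*) (\<lambda>T. spans (V1 \<union> V2) (arc_link T) s t)
     (a1 * b2 + b1 * a2) (b1 * b2)"
    by (rule two_level_parallel[where ?A1.0 = "\<lambda>T. spans V1 (arc_link T) s t \<and> (s, t) \<in> (arc_link T)\<^sup>*"
          and ?B1.0 = "\<lambda>T. spans V1 (arc_link T) s t"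
          and ?A2.0 = "\<lambda>T. spans V2 (arc_link T) s t \<and> (s, t) \<in> (arc_link T)\<^sup>*"
          and ?B2.0 = "\<lambda>T. spans V2 (arc_link T) s t", OF d])
      (use J Sp N1 N2 in \<open>auto simp: arc_network_def\<close>)
  ultimately show "arc_network (V1 \<union> V2) (E1 \<union> E2) s t (a1 * b2 + b1 * a2) (b1 * b2)"
    using N1 N2 st J[OF order_refl order_refl] Sp[OF order_refl order_refl] unfolding arc_network_def by simp
qed

lemma arc_network_edge:
  assumes "arc e"
  shows "arc_network (arc_ends e) {e} (pathstart e) (pathfinish e) 1 1"
proof -
  let ?s = "pathstart e" and ?t = "pathfinish e"
  have st: "?s \<noteq> ?t" using arc_distinct_ends[OF assms] by simp
  have L: "arc_link {e} = {(?s, ?t), (?t, ?s)}" "arc_link {} = ({} :: 'a rel)"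
    unfolding arc_link_def arc_ends_def by (auto simp: doubleton_eq_iff)
  have sp: "spans (arc_ends e) R ?s ?t" for R unfolding spans_def arc_ends_def by auto
  have j: "(?s, ?t) \<in> (arc_link {e})\<^sup>*" "(?s, ?t) \<notin> (arc_link {})\<^sup>*" using st unfolding L by auto
  let ?A = "\<lambda>T. spans (arc_ends e) (arc_link T) ?s ?t \<and> (?s, ?t) \<in> (arc_link T)\<^sup>*"
  have A: "?A {e}" "\<not> ?A {}" using j sp by auto
  have "minimal_sets {e} ?A = {{e}}"
  proof
    show "minimal_sets {e} ?A \<subseteq> {{e}}" using A(2) unfolding minimal_sets_def by (auto simp: subset_singleton_iff)
    show "{{e}} \<subseteq> minimal_sets {e} ?A" using A by (auto intro!: minimal_setsI simp: psubset_eq subset_singleton_iff)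
  qed
  \<comment> \<open>Both vertices are terminals, so already the empty edge set spans.\<close>
  moreover have "minimal_sets {e} (\<lambda>T. spans (arc_ends e) (arc_link T) ?s ?t) = {{}}"
  proof -
    have "T = {}" if "T \<in> minimal_sets {e} (\<lambda>T. spans (arc_ends e) (arc_link T) ?s ?t)" for T
      using minimal_sets_eqI[OF that, of "{}"] sp by simp
    moreover have "{} \<in> minimal_sets {e} (\<lambda>T. spans (arc_ends e) (arc_link T) ?s ?t)"
      using sp by (intro minimal_setsI) auto
    ultimately show ?thesis by blast
  qed
  ultimately have "two_level {e} ?A (\<lambda>T. spans (arc_ends e) (arc_link T) ?s ?t) 1 1"
    using A sp unfolding two_level_def by (auto simp: subset_singleton_iff)
  moreover have "plane_arcs (arc_ends e) {e}" using assms unfolding plane_arcs_def arc_ends_def by auto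
  ultimately show ?thesis using st j sp unfolding arc_network_def arc_ends_def by simp
qed

lemma two_level_image:
  assumes F: "inj_on F E" and A: "\<And>T. T \<subseteq> E \<Longrightarrow> A' (F ` T) \<longleftrightarrow> A T" and B: "\<And>T. T \<subseteq> E \<Longrightarrow> B' (F ` T) \<longleftrightarrow> B T"
    and L: "two_level E A B a b"
  shows "two_level (F ` E) A' B' a b"
proof -
  have "\<exists>f\<in>U. B' (U - {f})" if U: "U \<subseteq> F ` E" "A' U" for U
  proof -
    obtain T where T: "T \<subseteq> E" "U = F ` T" using U(1) by (meson subset_image_iff)
    then have "A T" using A[OF T(1)] U(2) by simp
    then obtain f where f: "f \<in> T" "B (T - {f})" using L T(1) unfolding two_level_def by meson
    have "F ` (T - {f}) = U - {F f}"
      using inj_on_image_set_diff[OF F, of T "{f}"] T f by auto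
    then have "B' (U - {F f})" using B[of "T - {f}"] T f by auto
    then show ?thesis using f T by auto
  qed
  then show ?thesis
    using L minimal_sets_image[where P' = A', OF F A] minimal_sets_image[where P' = B', OF F B]
    unfolding two_level_def by simp
qed

lemma arc_ends_compose: "arc_ends (f \<circ> g) = f ` arc_ends g"
  unfolding arc_ends_def by (simp add: pathstart_compose pathfinish_compose)

lemma arc_region_image: "arc_region (f ` V) ((\<circ>) f ` E) = f ` arc_region V E"
  unfolding arc_region_def by (auto simp: path_image_compose)

text \<open>Lets a network be redrawn inside a prescribed region before it is combined with another;
  the counts survive because reachability does.\<close>

lemma arc_network_image:
  assumes f: "inj f" "continuous_on UNIV f" and N: "arc_network V E s t a b"
  shows "arc_network (f ` V) ((\<circ>) f ` E) (f s) (f t) a b"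
proof -
  have injF: "inj_on ((\<circ>) f) E" using fun.inj_map[OF f(1)] by (rule inj_on_subset) simp
  have link: "(f u, f v) \<in> (arc_link ((\<circ>) f ` T))\<^sup>* \<longleftrightarrow> (u, v) \<in> (arc_link T)\<^sup>*" for u v T
  proof
    assume "(u, v) \<in> (arc_link T)\<^sup>*"
    then show "(f u, f v) \<in> (arc_link ((\<circ>) f ` T))\<^sup>*"
    proof (rule rtrancl_map)
      fix x y assume "(x, y) \<in> arc_link T"
      then obtain g where "g \<in> T" "arc_ends g = {x, y}" unfolding arc_link_def by auto
      then have "(f x, f y) \<in> arc_link ((\<circ>) f ` T)" unfolding arc_link_def by (auto simp: arc_ends_compose)
      then show "(f x, f y) \<in> (arc_link ((\<circ>) f ` T))\<^sup>*" by blast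
    qed
  next
    assume "(f u, f v) \<in> (arc_link ((\<circ>) f ` T))\<^sup>*"
    then have "(inv f (f u), inv f (f v)) \<in> (arc_link T)\<^sup>*"
    proof (rule rtrancl_map)
      fix x y assume "(x, y) \<in> arc_link ((\<circ>) f ` T)"
      then obtain g where g: "g \<in> T" "f ` arc_ends g = {x, y}" unfolding arc_link_def by (auto simp: arc_ends_compose)
      have "arc_ends g = inv f ` (f ` arc_ends g)" using f(1) by (simp add: image_image)
      then have "arc_ends g = {inv f x, inv f y}" using g(2) by simp
      then show "(inv f x, inv f y) \<in> (arc_link T)\<^sup>*" using g(1) unfolding arc_link_def by blast
    qed
    then show "(u, v) \<in> (arc_link T)\<^sup>*" using f(1) by simp
  qed
  have sp: "spans (f ` V) (arc_link ((\<circ>) f ` T)) (f s) (f t) \<longleftrightarrow> spans V (arc_link T) s t" for T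
    unfolding spans_def by (simp add: link)
  have P: "plane_arcs V E" using N unfolding arc_network_def by simp
  have arcs: "arc (f \<circ> g) \<and> path_image (f \<circ> g) \<inter> f ` V = arc_ends (f \<circ> g)" if "g \<in> E" for g
  proof -
    have g: "arc g" "path_image g \<inter> V = arc_ends g" using P that unfolding plane_arcs_def by simp_all
    then have "arc (f \<circ> g)"
      using f unfolding arc_def
      by (auto intro!: path_continuous_image comp_inj_on intro: continuous_on_subset inj_on_subset)
    then show ?thesis unfolding path_image_compose image_Int[OF f(1), symmetric] g(2) arc_ends_compose by simp
  qed
  have inter: "path_image (f \<circ> g) \<inter> path_image (f \<circ> h) \<subseteq> arc_ends (f \<circ> g) \<inter> arc_ends (f \<circ> h) \<and>
      arc_ends (f \<circ> g) \<noteq> arc_ends (f \<circ> h)"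
    if "g \<in> E" "h \<in> E" "f \<circ> g \<noteq> f \<circ> h" for g h
  proof -
    have "g \<noteq> h" using that(3) by blast
    then have "path_image g \<inter> path_image h \<subseteq> arc_ends g \<inter> arc_ends h" "arc_ends g \<noteq> arc_ends h"
      using P that unfolding plane_arcs_def by simp_all
    then show ?thesis
      unfolding path_image_compose arc_ends_compose image_Int[OF f(1), symmetric] inj_image_eq_iff[OF f(1)]
      by (simp only: image_mono) simp
  qed
  have "plane_arcs (f ` V) ((\<circ>) f ` E)"
    using P arcs inter unfolding plane_arcs_def by (simp only: ball_simps finite_imageI) simp
  moreover have "two_level ((\<circ>) f ` E) (\<lambda>T. spans (f ` V) (arc_link T) (f s) (f t) \<and> (f s, f t) \<in> (arc_link T)\<^sup>*)
      (\<lambda>T. spans (f ` V) (arc_link T) (f s) (f t)) a b"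
    using N by (intro two_level_image[OF injF]) (auto simp: sp link arc_network_def)
  ultimately show ?thesis using N f(1) unfolding arc_network_def by (simp add: sp link inj_eq)
qed

section \<open>From networks to multigraphs\<close>

definition arc_graph :: "'a::topological_space set \<Rightarrow> (real \<Rightarrow> 'a) set \<Rightarrow> ('a, real \<Rightarrow> 'a) mgraph" where
  "arc_graph V E = \<lparr>verts = V, edges = E, ends = arc_ends\<rparr>"

lemma connected_arc_graph_iff:
  assumes "s \<in> V" "t \<in> V"
  shows "connected_mgraph (arc_graph V T) \<longleftrightarrow> spans V (arc_link T) s t \<and> (s, t) \<in> (arc_link T)\<^sup>*"
proof -
  have adj: "adjacency (arc_graph V T) = arc_link T" unfolding adjacency_def arc_graph_def arc_link_def by simp
  have sy: "(y, x) \<in> (arc_link T)\<^sup>*" if "(x, y) \<in> (arc_link T)\<^sup>*" for x y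
    using that sym_rtrancl[OF sym_arc_link] by (meson symD)
  show ?thesis
  proof
    assume "connected_mgraph (arc_graph V T)"
    then show "spans V (arc_link T) s t \<and> (s, t) \<in> (arc_link T)\<^sup>*"
      using assms unfolding connected_mgraph_def adj spans_def by (simp add: arc_graph_def)
  next
    assume a: "spans V (arc_link T) s t \<and> (s, t) \<in> (arc_link T)\<^sup>*"
    then have "(v, s) \<in> (arc_link T)\<^sup>*" if "v \<in> V" for v
      using that sy unfolding spans_def by (meson rtrancl_trans)
    then have "(u, v) \<in> (arc_link T)\<^sup>*" if "u \<in> V" "v \<in> V" for u v
      using that sy by (meson rtrancl_trans)
    then show "connected_mgraph (arc_graph V T)"
      using assms unfolding connected_mgraph_def adj by (auto simp: arc_graph_def)
  qed
qed

text \<open>The edge e is a parallel network with both counts 1, hence \<open>a * 1 + b * 1\<close>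
  spanning trees. Once e is always present, connectedness only requires every vertex to reach s or
  t, and those minimal sets number b.\<close>

lemma arc_network_add_edge:
  assumes N: "arc_network V E s t a b" and e: "arc e" "pathstart e = s" "pathfinish e = t"
    and R: "arc_region V E \<inter> path_image e \<subseteq> {s, t}"
    and ne: "\<forall>g\<in>E. arc_ends g \<noteq> {s, t}"
  defines "G \<equiv> arc_graph V (insert e E)"
  shows "fin_mgraph G" "connected_mgraph G" "simple_mgraph G" "tau G = a + b" "tau (contract G e) = b"
    and "plane_arcs V (insert e E)"
proof -
  have st: "s \<in> V" "t \<in> V" "s \<noteq> t" using N unfolding arc_network_def by auto
  have ee: "arc_ends e = {s, t}" using e unfolding arc_ends_def by simp
  have eV: "V \<union> arc_ends e = V" using st ee by auto
  have "arc_region V E \<inter> arc_region (arc_ends e) {e} \<subseteq> {s, t}" using R ee unfolding arc_region_def by auto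
  note par = arc_network_parallel[OF N arc_network_edge[OF e(1), unfolded e] this bspec[OF ne]]
  have N': "arc_network V (insert e E) s t (a + b) b" using par(1) unfolding eV by simp
  show P: "plane_arcs V (insert e E)" using N' unfolding arc_network_def by simp
  have eE: "e \<notin> E" using ne ee by auto
  have ends: "arc_ends g \<subseteq> V" "card (arc_ends g) = 2" if "g \<in> insert e E" for g
  proof -
    show "arc_ends g \<subseteq> V" using plane_arcs_ends[OF P that] by simp
    show "card (arc_ends g) = 2" using plane_arcs_ends[OF P that] unfolding arc_ends_def by simp
  qed
  show fin: "fin_mgraph G" using P ends unfolding fin_mgraph_def G_def arc_graph_def plane_arcs_def by simp
  have "inj_on arc_ends (insert e E)" using P unfolding plane_arcs_def inj_on_def by blast
  then show simple: "simple_mgraph G" using ends unfolding simple_mgraph_def loopless_def G_def arc_graph_def by simp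
  show "connected_mgraph G" unfolding G_def connected_arc_graph_iff[OF st(1,2)] using N' unfolding arc_network_def by simp
  have G_edges: "G\<lparr>edges := T\<rparr> = arc_graph V T" for T unfolding G_def arc_graph_def by simp
  have edges: "edges G = insert e E" unfolding G_def arc_graph_def by simp
  show "tau G = a + b"
    unfolding tau_eq_card_minimal_sets[OF fin] G_edges connected_arc_graph_iff[OF st(1,2)] edges
    using N' unfolding arc_network_def two_level_def by simp
  have "minimal_sets E (\<lambda>T. connected_mgraph (arc_graph V (insert e T))) = minimal_sets E (\<lambda>T. spans V (arc_link T) s t)"
  proof (rule minimal_sets_cong)
    fix T assume T: "T \<subseteq> E"
    have L: "arc_link {e} = {(s, t), (t, s)}" using ee unfolding arc_link_def by (auto simp: doubleton_eq_iff)
    have i: "insert e T = T \<union> {e}" by simp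
    have "arc_link T \<subseteq> V \<times> V" using P T by (intro arc_link_subset[of V "insert e E"]) auto
    then have "spans (V \<union> {s, t}) (arc_link T \<union> arc_link {e}) s t \<longleftrightarrow>
        spans V (arc_link T) s t \<and> spans {s, t} (arc_link {e}) s t"
      using L by (intro spans_parallel) auto
    moreover have "V \<union> {s, t} = V" using st by auto
    moreover have "spans {s, t} (arc_link {e}) s t" unfolding spans_def by auto
    moreover have "(s, t) \<in> (arc_link T \<union> arc_link {e})\<^sup>*" unfolding L by auto
    ultimately show "connected_mgraph (arc_graph V (insert e T)) \<longleftrightarrow> spans V (arc_link T) s t"
      unfolding connected_arc_graph_iff[OF st(1,2)] i arc_link_Un by simp
  qed
  moreover have "edges G - {e} = E" "e \<in> edges G" using edges eE by auto
  ultimately show "tau (contract G e) = b"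
    using tau_contract_eq_card_minimal_sets[OF fin simple, of e] N
    unfolding G_edges arc_network_def two_level_def by simp
qed

section \<open>Drawings inside a triangle\<close>

definition tent :: "real \<Rightarrow> real" where "tent x = min x (1 - x)"

text \<open>This triangle contains two half-size copies of itself side by side, which meet in one
  point, and also two vertically compressed copies, which meet only in the terminals. Both
  compositions can therefore be drawn inside it again.\<close>

definition lens :: "(real \<times> real) set" where
  "lens = {(x, y). 0 \<le> x \<and> x \<le> 1 \<and> 0 \<le> y \<and> y \<le> tent x}"

definition lens_network :: "(real \<times> real) set \<Rightarrow> (real \<Rightarrow> real \<times> real) set \<Rightarrow> nat \<Rightarrow> nat \<Rightarrow> bool" where
  "lens_network V E a b \<longleftrightarrow> arc_network V E (0, 0) (1, 0) a b \<and> arc_region V E \<subseteq> lens"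

lemma lens_network_edge:
  "lens_network {(0, 0), (1, 0)} {linepath (0, 0) (1, 0)} 1 1"
proof -
  let ?e = "linepath (0, 0) (1, 0) :: real \<Rightarrow> real \<times> real"
  have e: "arc ?e" by (simp add: arc_linepath)
  have ends: "arc_ends ?e = {(0, 0), (1, 0)}" unfolding arc_ends_def by simp
  have "path_image ?e \<subseteq> lens" unfolding path_image_linepath closed_segment_def lens_def tent_def by auto
  moreover have "{(0, 0), (1, 0)} \<subseteq> lens" unfolding lens_def tent_def by simp
  ultimately show ?thesis
    using arc_network_edge[OF e] unfolding ends lens_network_def arc_region_def by simp
qed

lemma lens_network_finite: "lens_network V E a b \<Longrightarrow> finite V"
  unfolding lens_network_def arc_network_def plane_arcs_def by simp

lemma lens_network_series:
  assumes N1: "lens_network V1 E1 a1 b1" and N2: "lens_network V2 E2 a2 b2"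
  shows "\<exists>V E. lens_network V E (a1 * a2) (a1 * b2 + b1 * a2) \<and>
    (\<forall>g\<in>E. arc_ends g \<noteq> {(0, 0), (1, 0)}) \<and> card V + 1 = card V1 + card V2"
proof -
  define f1 f2 :: "real \<times> real \<Rightarrow> real \<times> real"
    where "f1 = (\<lambda>p. (fst p / 2, snd p / 2))" and "f2 = (\<lambda>p. (fst p / 2 + 1 / 2, snd p / 2))"
  have inj: "inj f1" "inj f2" unfolding f1_def f2_def inj_def by (auto simp: prod_eq_iff)
  have cont: "continuous_on UNIV f1" "continuous_on UNIV f2"
    unfolding f1_def f2_def by (intro continuous_intros; simp)+
  have l: "f1 ` lens \<subseteq> lens" "f2 ` lens \<subseteq> lens" "f1 ` lens \<inter> f2 ` lens \<subseteq> {(1 / 2, 0)}"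
    unfolding f1_def f2_def lens_def tent_def by (auto simp: min_def split: if_splits)
  have pts: "f1 (0, 0) = (0, 0)" "f1 (1, 0) = (1 / 2, 0)" "f2 (0, 0) = (1 / 2, 0)" "f2 (1, 0) = (1, 0)"
    unfolding f1_def f2_def by auto
  have M1: "arc_network (f1 ` V1) ((\<circ>) f1 ` E1) (0, 0) (1 / 2, 0) a1 b1"
    using arc_network_image[OF inj(1) cont(1)] N1 unfolding lens_network_def by (metis pts(1,2))
  have M2: "arc_network (f2 ` V2) ((\<circ>) f2 ` E2) (1 / 2, 0) (1, 0) a2 b2"
    using arc_network_image[OF inj(2) cont(2)] N2 unfolding lens_network_def by (metis pts(3,4))
  have r1: "arc_region (f1 ` V1) ((\<circ>) f1 ` E1) \<subseteq> f1 ` lens"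
    using N1 unfolding arc_region_image lens_network_def by (simp add: image_mono)
  have r2: "arc_region (f2 ` V2) ((\<circ>) f2 ` E2) \<subseteq> f2 ` lens"
    using N2 unfolding arc_region_image lens_network_def by (simp add: image_mono)
  have R: "arc_region (f1 ` V1) ((\<circ>) f1 ` E1) \<inter> arc_region (f2 ` V2) ((\<circ>) f2 ` E2) \<subseteq> {(1 / 2, 0)}"
    using r1 r2 l(3) by blast
  note S = arc_network_series[OF M1 M2 R]
  have "arc_region (f1 ` V1 \<union> f2 ` V2) ((\<circ>) f1 ` E1 \<union> (\<circ>) f2 ` E2) =
      arc_region (f1 ` V1) ((\<circ>) f1 ` E1) \<union> arc_region (f2 ` V2) ((\<circ>) f2 ` E2)"
    unfolding arc_region_def by auto
  then have "arc_region (f1 ` V1 \<union> f2 ` V2) ((\<circ>) f1 ` E1 \<union> (\<circ>) f2 ` E2) \<subseteq> lens" using r1 r2 l by blast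
  then have "lens_network (f1 ` V1 \<union> f2 ` V2) ((\<circ>) f1 ` E1 \<union> (\<circ>) f2 ` E2) (a1 * a2) (a1 * b2 + b1 * a2)"
    using S(1) unfolding lens_network_def by simp
  moreover have "card (f1 ` V1 \<union> f2 ` V2) + 1 = card V1 + card V2"
  proof -
    have "card (f1 ` V1) = card V1" "card (f2 ` V2) = card V2"
      using inj by (auto intro!: card_image intro: inj_on_subset)
    then show ?thesis
      using card_Un_Int[of "f1 ` V1" "f2 ` V2"] S(2) N1[THEN lens_network_finite] N2[THEN lens_network_finite] by simp
  qed
  ultimately show ?thesis using S(3) by blast
qed

text \<open>Squeezes the triangle into the band between two thirds of its height and its roof. Away
  from the terminals this also frees the base, where the edge e is drawn at the end.\<close>

definition upper :: "real \<times> real \<Rightarrow> real \<times> real" where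
  "upper p = (fst p, snd p / 3 + 2 / 3 * tent (fst p))"

lemma upper_lens:
  shows "inj upper" "continuous_on UNIV upper" "upper ` lens \<subseteq> lens" "upper (0, 0) = (0, 0)" "upper (1, 0) = (1, 0)"
proof -
  show "inj upper" unfolding upper_def inj_def by (auto simp: prod_eq_iff)
  show "continuous_on UNIV upper" unfolding upper_def tent_def by (intro continuous_intros; simp)
  show "upper ` lens \<subseteq> lens" unfolding upper_def lens_def tent_def
    by (auto simp: min_def field_simps split: if_splits)
  show "upper (0, 0) = (0, 0)" "upper (1, 0) = (1, 0)" unfolding upper_def tent_def by auto
qed

lemma lens_network_parallel:
  assumes N1: "lens_network V1 E1 a1 b1" "\<forall>g\<in>E1. arc_ends g \<noteq> {(0, 0), (1, 0)}"
    and N2: "lens_network V2 E2 a2 b2" "\<forall>g\<in>E2. arc_ends g \<noteq> {(0, 0), (1, 0)}"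
  shows "\<exists>V E. lens_network V E (a1 * b2 + b1 * a2) (b1 * b2) \<and>
    (\<forall>g\<in>E. arc_ends g \<noteq> {(0, 0), (1, 0)}) \<and> card V + 2 = card V1 + card V2"
proof -
  \<comment> \<open>The lower third; the empty middle third separates the two drawings everywhere
    except at the terminals.\<close>
  define f1 :: "real \<times> real \<Rightarrow> real \<times> real" where "f1 = (\<lambda>p. (fst p, snd p / 3))"
  let ?f2 = upper
  have inj: "inj f1" unfolding f1_def inj_def by (auto simp: prod_eq_iff)
  have cont: "continuous_on UNIV f1" unfolding f1_def by (intro continuous_intros; simp)
  have l: "f1 ` lens \<subseteq> lens" "f1 ` lens \<inter> ?f2 ` lens \<subseteq> {(0, 0), (1, 0)}"
    unfolding f1_def upper_def lens_def tent_def by (auto simp: min_def split: if_splits)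
  have pts: "f1 (0, 0) = (0, 0)" "f1 (1, 0) = (1, 0)"
    unfolding f1_def by auto
  have M1: "arc_network (f1 ` V1) ((\<circ>) f1 ` E1) (0, 0) (1, 0) a1 b1"
    using arc_network_image[OF inj cont] N1(1) unfolding lens_network_def by (metis pts)
  have M2: "arc_network (?f2 ` V2) ((\<circ>) ?f2 ` E2) (0, 0) (1, 0) a2 b2"
    using arc_network_image[OF upper_lens(1,2)] N2(1) unfolding lens_network_def by (metis upper_lens(4,5))
  have r1: "arc_region (f1 ` V1) ((\<circ>) f1 ` E1) \<subseteq> f1 ` lens"
    using N1 unfolding arc_region_image lens_network_def by (simp add: image_mono)
  have r2: "arc_region (?f2 ` V2) ((\<circ>) ?f2 ` E2) \<subseteq> ?f2 ` lens"
    using N2 unfolding arc_region_image lens_network_def by (simp add: image_mono)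
  have R: "arc_region (f1 ` V1) ((\<circ>) f1 ` E1) \<inter> arc_region (?f2 ` V2) ((\<circ>) ?f2 ` E2) \<subseteq> {(0, 0), (1, 0)}"
    using r1 r2 l(2) by blast
  have ne1: "arc_ends g \<noteq> {(0, 0), (1, 0)}" if g: "g \<in> (\<circ>) f1 ` E1" for g
  proof -
    obtain h where h: "h \<in> E1" "g = f1 \<circ> h" using g by blast
    have "f1 ` arc_ends h \<noteq> f1 ` {(0, 0), (1, 0)}" unfolding inj_image_eq_iff[OF inj] by (rule bspec[OF N1(2) h(1)])
    then show ?thesis using h(2) pts by (simp add: arc_ends_compose)
  qed
  have ne2: "arc_ends g \<noteq> {(0, 0), (1, 0)}" if g: "g \<in> (\<circ>) ?f2 ` E2" for g
  proof -
    obtain h where h: "h \<in> E2" "g = ?f2 \<circ> h" using g by blast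
    have "?f2 ` arc_ends h \<noteq> ?f2 ` {(0, 0), (1, 0)}" unfolding inj_image_eq_iff[OF upper_lens(1)] by (rule bspec[OF N2(2) h(1)])
    then show ?thesis using h(2) upper_lens(4,5) by (simp add: arc_ends_compose)
  qed
  note S = arc_network_parallel[OF M1 M2 R ne1]
  have "arc_region (f1 ` V1 \<union> ?f2 ` V2) ((\<circ>) f1 ` E1 \<union> (\<circ>) ?f2 ` E2) =
      arc_region (f1 ` V1) ((\<circ>) f1 ` E1) \<union> arc_region (?f2 ` V2) ((\<circ>) ?f2 ` E2)"
    unfolding arc_region_def by auto
  then have "arc_region (f1 ` V1 \<union> ?f2 ` V2) ((\<circ>) f1 ` E1 \<union> (\<circ>) ?f2 ` E2) \<subseteq> lens"
    using r1 r2 l upper_lens(3) by blast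
  then have "lens_network (f1 ` V1 \<union> ?f2 ` V2) ((\<circ>) f1 ` E1 \<union> (\<circ>) ?f2 ` E2) (a1 * b2 + b1 * a2) (b1 * b2)"
    using S(1) unfolding lens_network_def by simp
  moreover have "card (f1 ` V1 \<union> ?f2 ` V2) + 2 = card V1 + card V2"
  proof -
    have "card (f1 ` V1) = card V1" "card (?f2 ` V2) = card V2"
      using inj upper_lens(1) by (auto intro!: card_image intro: inj_on_subset)
    then show ?thesis
      using card_Un_Int[of "f1 ` V1" "?f2 ` V2"] S(2) N1(1)[THEN lens_network_finite] N2(1)[THEN lens_network_finite] by simp
  qed
  ultimately show ?thesis using ne1 ne2 by blast
qed

text \<open>Every unit resistor is realised by a path of two edges, so that no parallel edges arise;
  this doubles all resistances.\<close>

lemma lens_network_of_sp_resistance: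
  assumes "sp_resistance x n"
  shows "\<exists>V E a b. lens_network V E a b \<and> (\<forall>g\<in>E. arc_ends g \<noteq> {(0, 0), (1, 0)}) \<and>
    a > 0 \<and> real b = 2 * x * real a \<and> card V \<le> 2 * n + 1"
  using assms
proof induction
  case unit
  obtain V E where "lens_network V E (1 * 1) (1 * 1 + 1 * 1)" "\<forall>g\<in>E. arc_ends g \<noteq> {(0, 0), (1, 0)}"
    "card V + 1 = card {(0 :: real, 0 :: real), (1, 0)} + card {(0 :: real, 0 :: real), (1, 0)}"
    using lens_network_series[OF lens_network_edge lens_network_edge] by blast
  then show ?case by (intro exI[of _ V] exI[of _ E] exI[of _ 1] exI[of _ 2]) (simp add: numeral_2_eq_2)
next
  case (ser x m y n)
  then obtain V1 E1 a1 b1 V2 E2 a2 b2 where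
    N1: "lens_network V1 E1 a1 b1" "a1 > 0" "real b1 = 2 * x * real a1" "card V1 \<le> 2 * m + 1" and
    N2: "lens_network V2 E2 a2 b2" "a2 > 0" "real b2 = 2 * y * real a2" "card V2 \<le> 2 * n + 1"
    by blast
  obtain V E where V: "lens_network V E (a1 * a2) (a1 * b2 + b1 * a2)" "\<forall>g\<in>E. arc_ends g \<noteq> {(0, 0), (1, 0)}"
    "card V + 1 = card V1 + card V2" using lens_network_series[OF N1(1) N2(1)] by blast
  have "real (a1 * b2 + b1 * a2) = 2 * (x + y) * real (a1 * a2)" using N1(3) N2(3) by (simp add: algebra_simps)
  moreover have "a1 * a2 > 0" "card V \<le> 2 * (m + n) + 1" using N1 N2 V(3) by auto
  ultimately show ?case using V(1,2) by blast
next
  case (par x m y n)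
  then obtain V1 E1 a1 b1 V2 E2 a2 b2 where
    N1: "lens_network V1 E1 a1 b1" "\<forall>g\<in>E1. arc_ends g \<noteq> {(0, 0), (1, 0)}" "a1 > 0"
      "real b1 = 2 * x * real a1" "card V1 \<le> 2 * m + 1" and
    N2: "lens_network V2 E2 a2 b2" "\<forall>g\<in>E2. arc_ends g \<noteq> {(0, 0), (1, 0)}" "a2 > 0"
      "real b2 = 2 * y * real a2" "card V2 \<le> 2 * n + 1"
    by blast
  have xy: "x > 0" "y > 0" using par sp_resistance_pos by auto
  obtain V E where V: "lens_network V E (a1 * b2 + b1 * a2) (b1 * b2)" "\<forall>g\<in>E. arc_ends g \<noteq> {(0, 0), (1, 0)}"
    "card V + 2 = card V1 + card V2" using lens_network_parallel[OF N1(1,2) N2(1,2)] by blast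
  have "real (a1 * b2 + b1 * a2) = 2 * (x + y) * (real a1 * real a2)" using N1(4) N2(4) by (simp add: algebra_simps)
  moreover have "real (b1 * b2) = 4 * x * y * (real a1 * real a2)" using N1(4) N2(4) by simp
  ultimately have "real (b1 * b2) = 2 * (1 / (1 / x + 1 / y)) * real (a1 * b2 + b1 * a2)"
    using xy by (simp add: field_simps)
  moreover have "real b2 > 0" using N2 xy by simp
  then have "a1 * b2 + b1 * a2 > 0" using N1(3) by simp
  moreover have "card V \<le> 2 * (m + n) + 1" using N1 N2 V(3) by auto
  ultimately show ?case using V(1,2) by blast
next
  case (weaken x m n)
  then show ?case by (meson add_le_mono1 mult_le_mono2 order_trans)
qed

lemma planar_arc_graph:
  fixes V :: "(real \<times> real) set"
  assumes "plane_arcs V E"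
  shows "planar_mgraph (arc_graph V E)"
proof -
  have "plane_drawing (arc_graph V E) (\<lambda>v. v) (\<lambda>g. g)"
    using assms unfolding plane_drawing_def plane_arcs_def
    by (simp add: arc_graph_def arc_imp_simple_path arc_ends_def)
  then show ?thesis unfolding planar_mgraph_def by blast
qed

section \<open>Relabelling and the final estimate\<close>

text \<open>Both tree counts are transported through \<open>minimal_sets\<close>, so only
  connectivity of edge subsets has to be compared; no bijection between the contracted graphs is
  built.\<close>

lemma relabel_by_naturals:
  fixes G :: "('v, 'e) mgraph"
  assumes fin: "fin_mgraph G" and simple: "simple_mgraph G" and conn: "connected_mgraph G"
    and planar: "planar_mgraph G" and e: "e \<in> edges G"
  shows "\<exists>(H :: (nat, nat) mgraph) d. fin_mgraph H \<and> connected_mgraph H \<and> simple_mgraph H \<and> planar_mgraph H \<and>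
    d \<in> edges H \<and> tau H = tau G \<and> tau (contract H d) = tau (contract G e) \<and> card (verts H) = card (verts G)"
proof -
  have fv: "finite (verts G)" "finite (edges G)" using fin unfolding fin_mgraph_def by auto
  obtain p :: "'v \<Rightarrow> nat" where p: "inj_on p (verts G)" using finite_imp_inj_to_nat_seg[OF fv(1)] by blast
  obtain q :: "'e \<Rightarrow> nat" where q: "inj_on q (edges G)" using finite_imp_inj_to_nat_seg[OF fv(2)] by blast
  define p' where "p' = inv_into (verts G) p"
  define q' where "q' = inv_into (edges G) q"
  have p': "p' (p v) = v" if "v \<in> verts G" for v using p that unfolding p'_def by simp
  have q': "q' (q f) = f" if "f \<in> edges G" for f using q that unfolding q'_def by simp
  have ends: "ends G f \<subseteq> verts G" "card (ends G f) = 2" if "f \<in> edges G" for f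
    using fin simple that unfolding fin_mgraph_def simple_mgraph_def loopless_def by auto
  define H :: "(nat, nat) mgraph" where
    "H = \<lparr>verts = p ` verts G, edges = q ` edges G, ends = (\<lambda>n. p ` ends G (q' n))\<rparr>"
  have endsH: "ends H (q f) = p ` ends G f" if "f \<in> edges G" for f using q'[OF that] unfolding H_def by simp
  have pp: "p' ` p ` ends G f = ends G f" if "f \<in> edges G" for f
    using ends(1)[OF that] p' by (force simp: image_image)
  have cardH: "card (p ` ends G f) = card (ends G f)" if "f \<in> edges G" for f
    using ends(1)[OF that] p by (meson card_image inj_on_subset)
  have finH: "fin_mgraph H"
    using fv ends cardH unfolding fin_mgraph_def by (auto simp: H_def q' image_mono)
  have "inj_on (ends H) (edges H)"
  proof (rule inj_onI)
    fix m n assume mn: "m \<in> edges H" "n \<in> edges H" "ends H m = ends H n"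
    then obtain f g where fg: "f \<in> edges G" "g \<in> edges G" "m = q f" "n = q g" unfolding H_def by auto
    then have "p' ` p ` ends G f = p' ` p ` ends G g" using mn(3) endsH by simp
    then have "f = g" using pp fg simple unfolding simple_mgraph_def inj_on_def by metis
    then show "m = n" using fg by simp
  qed
  then have simpleH: "simple_mgraph H"
    using ends cardH unfolding simple_mgraph_def loopless_def by (auto simp: H_def q')
  have conn_iff: "connected_mgraph (H\<lparr>edges := q ` T\<rparr>) \<longleftrightarrow> connected_mgraph (G\<lparr>edges := T\<rparr>)" if T: "T \<subseteq> edges G" for T
  proof -
    let ?AG = "adjacency (G\<lparr>edges := T\<rparr>)" and ?AH = "adjacency (H\<lparr>edges := q ` T\<rparr>)"
    have 1: "(p u, p v) \<in> ?AH\<^sup>*" if "(u, v) \<in> ?AG\<^sup>*" for u v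
      using that
    proof (rule rtrancl_map)
      fix x y assume "(x, y) \<in> ?AG"
      then obtain f where f: "f \<in> T" "ends G f = {x, y}" unfolding adjacency_def by auto
      then have "ends H (q f) = {p x, p y}" using endsH[of f] T by auto
      then have "(p x, p y) \<in> ?AH" using f unfolding adjacency_def by auto
      then show "(p x, p y) \<in> ?AH\<^sup>*" by blast
    qed
    have 2: "(p' u, p' v) \<in> ?AG\<^sup>*" if "(u, v) \<in> ?AH\<^sup>*" for u v
      using that
    proof (rule rtrancl_map)
      fix x y assume "(x, y) \<in> ?AH"
      then obtain f where f: "f \<in> T" "ends H (q f) = {x, y}" unfolding adjacency_def by auto
      then have "p ` ends G f = {x, y}" using endsH[of f] T by auto
      then have "ends G f = {p' x, p' y}" using pp[of f] f(1) T by auto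
      then have "(p' x, p' y) \<in> ?AG" using f unfolding adjacency_def by auto
      then show "(p' x, p' y) \<in> ?AG\<^sup>*" by blast
    qed
    have "(p u, p v) \<in> ?AH\<^sup>* \<longleftrightarrow> (u, v) \<in> ?AG\<^sup>*" if "u \<in> verts G" "v \<in> verts G" for u v
      using 1[of u v] 2[of "p u" "p v"] p'[OF that(1)] p'[OF that(2)] by auto
    moreover have "verts (H\<lparr>edges := q ` T\<rparr>) = p ` verts G" unfolding H_def by simp
    ultimately show ?thesis unfolding connected_mgraph_def by simp
  qed
  have edgesH: "edges H = q ` edges G" unfolding H_def by simp
  have "connected_mgraph H" using conn_iff[of "edges G"] conn unfolding edgesH[symmetric] by simp
  moreover have "planar_mgraph H"
  proof -
    obtain P \<gamma> where D: "plane_drawing G P \<gamma>" using planar unfolding planar_mgraph_def by blast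
    have Pp: "(P \<circ> p') ` p ` ends G f = P ` ends G f" if "f \<in> edges G" for f
      unfolding image_comp[symmetric] pp[OF that] ..
    have Pv: "(P \<circ> p') ` p ` verts G = P ` verts G" using p' by (force simp: image_image)
    have inj: "inj_on (P \<circ> p') (p ` verts G)" using D p' unfolding plane_drawing_def inj_on_def by auto
    have Pi: "(P \<circ> p') ` (ends H (q f) \<inter> ends H (q g)) = P ` (ends G f \<inter> ends G g)"
      if "f \<in> edges G" "g \<in> edges G" for f g
    proof -
      have "ends H (q f) \<inter> ends H (q g) = p ` (ends G f \<inter> ends G g)"
        using ends(1)[OF that(1)] ends(1)[OF that(2)] inj_on_image_Int[OF p] endsH that by simp
      moreover have "p' ` p ` (ends G f \<inter> ends G g) = ends G f \<inter> ends G g"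
        using ends(1)[OF that(1)] p' by (force simp: image_image)
      ultimately show ?thesis by (metis image_comp)
    qed
    have arcs: "simple_path ((\<gamma> \<circ> q') (q f)) \<and>
        {pathstart ((\<gamma> \<circ> q') (q f)), pathfinish ((\<gamma> \<circ> q') (q f))} = (P \<circ> p') ` ends H (q f) \<and>
        path_image ((\<gamma> \<circ> q') (q f)) \<inter> (P \<circ> p') ` verts H = (P \<circ> p') ` ends H (q f)"
      if f: "f \<in> edges G" for f
    proof -
      have "verts H = p ` verts G" "(\<gamma> \<circ> q') (q f) = \<gamma> f" using q'[OF f] unfolding H_def by simp_all
      then show ?thesis
        using D f unfolding plane_drawing_def endsH[OF f] Pp[OF f] by (simp only: Pv)
    qed
    have inter: "path_image ((\<gamma> \<circ> q') (q f)) \<inter> path_image ((\<gamma> \<circ> q') (q g)) \<subseteq> (P \<circ> p') ` (ends H (q f) \<inter> ends H (q g))"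
      if "f \<in> edges G" "g \<in> edges G" "q f \<noteq> q g" for f g
    proof -
      have "f \<noteq> g" using that(3) by blast
      then show ?thesis
        using D that q' unfolding plane_drawing_def Pi[OF that(1,2)] by simp
    qed
    have "plane_drawing H (P \<circ> p') (\<gamma> \<circ> q')"
      unfolding plane_drawing_def edgesH
    proof (intro conjI ballI impI)
      show "inj_on (P \<circ> p') (verts H)" using inj unfolding H_def by simp
    next
      fix m n assume "m \<in> q ` edges G" "n \<in> q ` edges G" "m \<noteq> n"
      then show "path_image ((\<gamma> \<circ> q') m) \<inter> path_image ((\<gamma> \<circ> q') n) \<subseteq> (P \<circ> p') ` (ends H m \<inter> ends H n)"
        using inter by fast
    qed (use arcs in fast)+
    then show ?thesis unfolding planar_mgraph_def by blast
  qed
  moreover have "tau H = tau G"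
    unfolding tau_eq_card_minimal_sets[OF fin] tau_eq_card_minimal_sets[OF finH] edgesH
    by (rule minimal_sets_image[OF q]) (rule conn_iff)
  moreover have "tau (contract H (q e)) = tau (contract G e)"
  proof -
    have "q ` edges G - {q e} = q ` (edges G - {e})" using e inj_on_image_set_diff[OF q, of "edges G" "{e}"] by auto
    moreover have "card (minimal_sets (q ` (edges G - {e})) (\<lambda>T. connected_mgraph (H\<lparr>edges := insert (q e) T\<rparr>))) =
        card (minimal_sets (edges G - {e}) (\<lambda>T. connected_mgraph (G\<lparr>edges := insert e T\<rparr>)))"
    proof (rule minimal_sets_image)
      show "inj_on q (edges G - {e})" using q by (rule inj_on_subset) simp
      fix T assume "T \<subseteq> edges G - {e}"
      then have "insert e T \<subseteq> edges G" using e by auto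
      then show "connected_mgraph (H\<lparr>edges := insert (q e) (q ` T)\<rparr>) \<longleftrightarrow> connected_mgraph (G\<lparr>edges := insert e T\<rparr>)"
        using conn_iff[of "insert e T"] by simp
    qed
    moreover have "q e \<in> edges H" using e unfolding edgesH by simp
    ultimately show ?thesis
      using tau_contract_eq_card_minimal_sets[OF fin simple e] tau_contract_eq_card_minimal_sets[OF finH simpleH, of "q e"]
      unfolding edgesH by simp
  qed
  moreover have "card (verts H) = card (verts G)" using p unfolding H_def by (simp add: card_image)
  moreover have "q e \<in> edges H" using e unfolding edgesH by simp
  ultimately show ?thesis using finH simpleH by blast
qed

lemma graph_of_sp_resistance:
  assumes x: "sp_resistance x n"
  shows "\<exists>(G :: (nat, nat) mgraph) e. fin_mgraph G \<and> connected_mgraph G \<and> simple_mgraph G \<and> planar_mgraph G \<and>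
    e \<in> edges G \<and> eff_resistance G e = 2 * x / (1 + 2 * x) \<and> card (verts G) \<le> 2 * n + 1"
proof -
  obtain V E a b where N: "lens_network V E a b" "\<forall>g\<in>E. arc_ends g \<noteq> {(0, 0), (1, 0)}"
    "a > 0" "real b = 2 * x * real a" "card V \<le> 2 * n + 1"
    using lens_network_of_sp_resistance[OF x] by blast
  \<comment> \<open>Moving the network off the base of the triangle makes room for e as a straight
    segment.\<close>
  let ?V = "upper ` V" and ?E = "(\<circ>) upper ` E" and ?e = "linepath (0, 0) (1, 0) :: real \<Rightarrow> real \<times> real"
  have M: "arc_network ?V ?E (0, 0) (1, 0) a b"
    using arc_network_image[OF upper_lens(1,2)] N(1) unfolding lens_network_def by (metis upper_lens(4,5))
  have e: "arc ?e" "pathstart ?e = (0, 0)" "pathfinish ?e = (1, 0)" by (auto simp: arc_linepath)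
  have "arc_region ?V ?E \<subseteq> upper ` lens"
    using N(1) unfolding arc_region_image lens_network_def by (simp add: image_mono)
  moreover have "upper ` lens \<inter> path_image ?e \<subseteq> {(0, 0), (1, 0)}"
    unfolding path_image_linepath closed_segment_def upper_def lens_def tent_def
    by (auto simp: min_def field_simps split: if_splits)
  ultimately have R: "arc_region ?V ?E \<inter> path_image ?e \<subseteq> {(0, 0), (1, 0)}" by blast
  have ne: "arc_ends g \<noteq> {(0, 0), (1, 0)}" if g: "g \<in> ?E" for g
  proof -
    obtain h where h: "h \<in> E" "g = upper \<circ> h" using g by blast
    have "upper ` arc_ends h \<noteq> upper ` {(0, 0), (1, 0)}" unfolding inj_image_eq_iff[OF upper_lens(1)] by (rule bspec[OF N(2) h(1)])
    then show ?thesis using h(2) upper_lens(4,5) by (simp add: arc_ends_compose)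
  qed
  then have "\<forall>g\<in>?E. arc_ends g \<noteq> {(0, 0), (1, 0)}" by blast
  note G = arc_network_add_edge[OF M e R this]
  have vs: "verts (arc_graph ?V (insert ?e ?E)) = ?V" and ee: "?e \<in> edges (arc_graph ?V (insert ?e ?E))"
    unfolding arc_graph_def by simp_all
  from relabel_by_naturals[OF G(1,3,2) planar_arc_graph[OF G(6)] ee]
  obtain H :: "(nat, nat) mgraph" and d where H: "fin_mgraph H" "connected_mgraph H" "simple_mgraph H" "planar_mgraph H"
    "d \<in> edges H" "tau H = a + b" "tau (contract H d) = b" "card (verts H) = card ?V"
    unfolding G(4,5) vs by blast
  have "eff_resistance H d = 2 * x / (1 + 2 * x)"
  proof -
    have x0: "x > 0" using sp_resistance_pos[OF x] .
    have "eff_resistance H d = (2 * x * real a) / ((1 + 2 * x) * real a)"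
      unfolding eff_resistance_def H(6,7) of_nat_add N(4) by (simp add: algebra_simps)
    then show ?thesis using N(3) by simp
  qed
  moreover have "card ?V = card V" using upper_lens(1) by (auto intro!: card_image intro: inj_on_subset)
  then have "card (verts H) \<le> 2 * n + 1" using H(8) N(5) by simp
  ultimately show ?thesis using H by blast
qed

theorem theorem1p1:
  "\<exists>C::real. C > 0 \<and>
     (\<forall>(t::nat) (c::nat). t > c \<and> c \<ge> 1 \<and> coprime t c \<longrightarrow>
        (\<exists>(G::(nat, nat) mgraph) e.
           fin_mgraph G \<and> connected_mgraph G \<and> simple_mgraph G \<and> planar_mgraph G \<and>
           e \<in> edges G \<and>
           eff_resistance G e = real c / real t \<and>
           real (card (verts G))
             \<le> C * Max {real t / real c, real t / (real t - real c), ln (real t)}))"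
proof -
  have *: "\<exists>(G::(nat, nat) mgraph) e.
           fin_mgraph G \<and> connected_mgraph G \<and> simple_mgraph G \<and> planar_mgraph G \<and>
           e \<in> edges G \<and>
           eff_resistance G e = real c / real t \<and>
           real (card (verts G))
             \<le> 2585 * Max {real t / real c, real t / (real t - real c), ln (real t)}"
    if ct: "c < t" "1 \<le> c" for t c :: nat
  proof -
    define d where "d = t - c"
    have d: "d > 0" "t = c + d" using ct unfolding d_def by auto
    define M where "M = Max {real t / real c, real t / (real t - real c), ln (real t)}"
    have M: "real t / real c \<le> M" "real t / real d \<le> M" "ln (real t) \<le> M" unfolding M_def d(2) by auto
    \<comment> \<open>The denominator is 2 d and not d because two-edge paths double every
      resistance: the network then has resistance c / d, and adding e gives c / (c + d) = c /
      t.\<close>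
    obtain n where n: "sp_resistance (real c / real (2 * d)) n"
      "real n \<le> max (real c / real (2 * d)) (real (2 * d) / real c) + 215 * log (3 / 2) (real (c + 2 * d))"
      using sp_resistance_rational[of c "2 * d"] ct d by auto
    have "1 \<le> real t / real c" using ct by simp
    then have M1: "1 \<le> M" using M(1) by simp
    have "real c / real (2 * d) \<le> real t / real d" using d by (simp add: field_simps)
    moreover have "real (2 * d) / real c \<le> 2 * (real t / real c)" using d ct by (simp add: field_simps)
    ultimately have m: "max (real c / real (2 * d)) (real (2 * d) / real c) \<le> 2 * M" using M M1 by simp
    have t2: "t \<ge> 2" using ct by simp
    \<comment> \<open>c + 2 d \<le> 2 t \<le> t^2 bounds the natural logarithm by 2 M, and ln (3/2)
      \<ge> 1/3 makes the change of base cost a factor of at most 3.\<close>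
    have "log (3 / 2) (real (c + 2 * d)) \<le> 6 * M"
    proof -
      have "real (c + 2 * d) \<le> real t * 2" using d by simp
      also have "\<dots> \<le> real t * real t" using t2 by (intro mult_left_mono) auto
      finally have "ln (real (c + 2 * d)) \<le> ln (real t * real t)" using d by simp
      also have "\<dots> = 2 * ln (real t)" using t2 by (simp add: ln_mult)
      finally have l: "ln (real (c + 2 * d)) \<le> 2 * M" using M(3) by simp
      have "ln (3 / 2) = - ln (2 / 3 :: real)" using ln_inverse[of "2 / 3 :: real"] by simp
      then have l2: "1 / 3 \<le> ln (3 / 2 :: real)" using ln_le_minus_one[of "2 / 3 :: real"] by simp
      have "2 * M \<le> 6 * M * ln (3 / 2)" using mult_left_mono[OF l2, of "6 * M"] M1 by simp
      then show ?thesis using l l2 unfolding log_def by (simp add: pos_divide_le_eq)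
    qed
    \<comment> \<open>2 + 215 * 6 = 1292; the vertex bound 2 n + 1 together with M \<ge> 1 then
      gives 2 * 1292 + 1 = 2585.\<close>
    then have "real n \<le> 1292 * M" using n(2) m by linarith
    obtain G :: "(nat, nat) mgraph" and e where G: "fin_mgraph G" "connected_mgraph G" "simple_mgraph G" "planar_mgraph G"
      "e \<in> edges G" "eff_resistance G e = 2 * (real c / real (2 * d)) / (1 + 2 * (real c / real (2 * d)))"
      "card (verts G) \<le> 2 * n + 1"
      using graph_of_sp_resistance[OF n(1)] by blast
    have "eff_resistance G e = real c / real t" unfolding G(6) d(2) using d ct by (simp add: field_simps)
    moreover have "real (card (verts G)) \<le> 2585 * M"
    proof -
      have "real (card (verts G)) \<le> 2 * real n + 1" using G(7) by linarith
      then show ?thesis using \<open>real n \<le> 1292 * M\<close> M1 by linarith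
    qed
    ultimately show ?thesis using G(1-5) unfolding M_def by blast
  qed
  show ?thesis by (rule exI[of _ 2585]) (use * in simp)
qed

end
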